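(* Let $R$ be a connected reduced order with degree map $d$, and suppose $(A,G),(B,H)\in\mathcal{D}(R)$ are such that $A$ and $B$ are stark. Then $A\cong B$ as rings, $G\cong H$ as groups, and $(A,G)$, $(A,H)$, $(B,G)$ and $(B,H)$ all lie in $\mathcal{D}(R)$ and are in the same $U^*(d)$-orbit of $\mathcal{D}(R)$.
   Context: All rings have a unit element. An order is a commutative ring whose additive group is isomorphic to $\mathbb{Z}^n$; reduced means no non-zero nilpotents, connected means exactly two idempotents; a commutative ring is stark if it is not isomorphic to a group ring $C[J]$ with $J$ a non-trivial group. $\mathcal{D}(R)$ is the set of pairs $(A,G)$ with $A\subset R$ a subring and $G\subset R^*$ a subgroup such that the natural map from the group ring $A[G]$ to $R$ is an isomorphism. A grading of $R$ is a pair $(\Delta,(R_\delta)_\delta)$ with $\Delta$ an abelian group and $R_\delta$ additive subgroups with $R_\gamma R_\delta\subset R_{\gamma\delta}$ and $\bigoplus_\delta R_\delta\to R$ bijective; it is universal if every grading is the pushforward $(E,(\sum_{\delta\in f^{-1}\epsilon}R_\delta)_\epsilon)$ along a unique homomorphism $f$ from its group. A reduced order has a universal grading $(\Gamma,(R_\gamma)_\gamma)$ with $\Gamma$ finite; for connected reduced $R$ each root of unity $\zeta\in\mu=\mu(R)$ lies in $R_\gamma$ for a unique $\gamma$, and the degree map $d\colon\mu\to\Gamma$, $\zeta\mapsto\gamma$, is a homomorphism. $Q(d)=\mathbb{Z}\oplus\operatorname{Hom}(\Gamma,\mu)$ is the ring with $(m,f)\star(n,g)=(mn,mg+nf+f\circ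 d\circ g)$ (Hom groups written additively); $U^*(d)=(1+\operatorname{Hom}(\Gamma,\mu))\cap Q(d)^*$. The element $1+f\in U^*(d)$ acts on $R$ by the ring automorphism $x\mapsto f(\gamma)\cdot x$ for $x\in R_\gamma$ (extended additively), and hence on $\mathcal{D}(R)$ componentwise. *)

theory Defs
  imports "HOL-Algebra.Group" "HOL-Library.FuncSet"
begin

text \<open>The ambient ring R is the whole type 'a (a comm_ring_1).\<close>

definition is_order :: "'a::comm_ring_1 itself \<Rightarrow> bool" where
  "is_order _ \<longleftrightarrow> (\<exists>(n::nat) (b::nat \<Rightarrow> 'a). \<forall>x::'a. \<exists>!k::nat \<Rightarrow> int.
      (\<forall>i\<ge>n. k i = 0) \<and> x = (\<Sum>i<n. of_int (k i) * b i))"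

definition reduced_ring :: "'a::comm_ring_1 itself \<Rightarrow> bool" where
  "reduced_ring _ \<longleftrightarrow> (\<forall>(x::'a) (n::nat). x ^ n = 0 \<longrightarrow> x = 0)"

definition connected_ring :: "'a::comm_ring_1 itself \<Rightarrow> bool" where
  "connected_ring _ \<longleftrightarrow> card {e::'a. e * e = e} = 2"

definition subring_of :: "'a::comm_ring_1 set \<Rightarrow> 'a set \<Rightarrow> bool" where
  "subring_of A S \<longleftrightarrow> A \<subseteq> S \<and> 1 \<in> A \<and> (\<forall>x\<in>A. \<forall>y\<in>A. x - y \<in> A \<and> x * y \<in> A)"

definition unit_subgroup_of :: "'a::comm_ring_1 set \<Rightarrow> 'a set \<Rightarrow> bool" where
  "unit_subgroup_of G S \<longleftrightarrow> G \<subseteq> S \<and> 1 \<in> G \<and> (\<forall>x\<in>G. \<forall>y\<in>G. x * y \<in> G)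
      \<and> (\<forall>x\<in>G. \<exists>y\<in>G. x * y = 1)"

text \<open>D(S): pairs (A,G) such that the natural map A[G] -> S,
  (finitely supported c : G -> A) |-> sum of c(g) g, is bijective.\<close>
definition D_of :: "'a::comm_ring_1 set \<Rightarrow> ('a set \<times> 'a set) set" where
  "D_of S = {(A, G). subring_of A S \<and> unit_subgroup_of G S \<and>
     (\<forall>x\<in>S. \<exists>!c::'a \<Rightarrow> 'a. (\<forall>g. c g \<in> A) \<and> (\<forall>g. c g \<noteq> 0 \<longrightarrow> g \<in> G)
        \<and> finite {g. c g \<noteq> 0} \<and> x = (\<Sum>g\<in>{g. c g \<noteq> 0}. c g * g))}"

abbreviation DR :: "('a::comm_ring_1 set \<times> 'a set) set" where
  "DR \<equiv> D_of UNIV"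

text \<open>Stark: not (isomorphic to) a group ring C[J] with J non-trivial; rendered internally:
  every decomposition of A as a group ring C[K] has K trivial.\<close>
definition stark :: "'a::comm_ring_1 set \<Rightarrow> bool" where
  "stark A \<longleftrightarrow> (\<forall>C K. (C, K) \<in> D_of A \<longrightarrow> K = {1})"

definition ring_iso_on :: "('a::comm_ring_1 \<Rightarrow> 'a) \<Rightarrow> 'a set \<Rightarrow> 'a set \<Rightarrow> bool" where
  "ring_iso_on \<phi> A B \<longleftrightarrow> bij_betw \<phi> A B \<and> \<phi> 1 = 1 \<and>
     (\<forall>x\<in>A. \<forall>y\<in>A. \<phi> (x + y) = \<phi> x + \<phi> y \<and> \<phi> (x * y) = \<phi> x * \<phi> y)"

definition grp_iso_on :: "('a::comm_ring_1 \<Rightarrow> 'a) \<Rightarrow> 'a set \<Rightarrow> 'a set \<Rightarrow> bool" where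
  "grp_iso_on \<psi> G H \<longleftrightarrow> bij_betw \<psi> G H \<and> (\<forall>x\<in>G. \<forall>y\<in>G. \<psi> (x * y) = \<psi> x * \<psi> y)"

definition grading :: "('e, 'm) monoid_scheme \<Rightarrow> ('e \<Rightarrow> 'a::comm_ring_1 set) \<Rightarrow> bool" where
  "grading \<Delta> Rd \<longleftrightarrow> comm_group \<Delta> \<and>
     (\<forall>\<delta>\<in>carrier \<Delta>. 0 \<in> Rd \<delta> \<and> (\<forall>x\<in>Rd \<delta>. \<forall>y\<in>Rd \<delta>. x - y \<in> Rd \<delta>)) \<and>
     (\<forall>\<gamma>\<in>carrier \<Delta>. \<forall>\<delta>\<in>carrier \<Delta>. \<forall>x\<in>Rd \<gamma>. \<forall>y\<in>Rd \<delta>. x * y \<in> Rd (\<gamma> \<otimes>\<^bsub>\<Delta>\<^esub> \<delta>)) \<and>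
     (\<forall>x::'a. \<exists>!c::'e \<Rightarrow> 'a. (\<forall>\<delta>. \<delta> \<notin> carrier \<Delta> \<longrightarrow> c \<delta> = 0) \<and> (\<forall>\<delta>\<in>carrier \<Delta>. c \<delta> \<in> Rd \<delta>)
        \<and> finite {\<delta>. c \<delta> \<noteq> 0} \<and> x = sum c {\<delta>. c \<delta> \<noteq> 0})"

definition pushforward :: "('g, 'm) monoid_scheme \<Rightarrow> ('g \<Rightarrow> 'a::comm_ring_1 set) \<Rightarrow> ('g \<Rightarrow> 'e) \<Rightarrow> 'e \<Rightarrow> 'a set" where
  "pushforward \<Gamma> Rg f \<epsilon> = {x. \<exists>c::'g \<Rightarrow> 'a. (\<forall>\<gamma>. c \<gamma> \<noteq> 0 \<longrightarrow> \<gamma> \<in> carrier \<Gamma> \<and> f \<gamma> = \<epsilon>)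
      \<and> (\<forall>\<gamma>\<in>carrier \<Gamma>. c \<gamma> \<in> Rg \<gamma>) \<and> finite {\<gamma>. c \<gamma> \<noteq> 0} \<and> x = sum c {\<gamma>. c \<gamma> \<noteq> 0}}"

definition universal_grading :: "('g, 'm) monoid_scheme \<Rightarrow> ('g \<Rightarrow> 'a::comm_ring_1 set) \<Rightarrow> bool" where
  "universal_grading \<Gamma> Rg \<longleftrightarrow> grading \<Gamma> Rg \<and>
     (\<forall>(E::nat monoid) (Re::nat \<Rightarrow> 'a set). grading E Re \<longrightarrow>
        (\<exists>!f. f \<in> hom \<Gamma> E \<and> f \<in> extensional (carrier \<Gamma>) \<and>
              (\<forall>\<epsilon>\<in>carrier E. Re \<epsilon> = pushforward \<Gamma> Rg f \<epsilon>)))"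

definition roots_of_unity :: "'a::comm_ring_1 set" where
  "roots_of_unity = {z. \<exists>n::nat. n > 0 \<and> z ^ n = 1}"

definition mu_grp :: "'a::comm_ring_1 monoid" where
  "mu_grp = \<lparr>carrier = roots_of_unity, mult = (*), one = 1\<rparr>"

definition degree_map :: "('g, 'm) monoid_scheme \<Rightarrow> ('g \<Rightarrow> 'a::comm_ring_1 set) \<Rightarrow> 'a \<Rightarrow> 'g" where
  "degree_map \<Gamma> Rg z = (THE \<gamma>. \<gamma> \<in> carrier \<Gamma> \<and> z \<in> Rg \<gamma>)"

text \<open>Hom(Gamma, mu), written additively in the paper (addition = pointwise product).\<close>
definition Hom_mu :: "('g, 'm) monoid_scheme \<Rightarrow> ('g \<Rightarrow> 'a::comm_ring_1) set" where
  "Hom_mu \<Gamma> = {f. f \<in> hom \<Gamma> mu_grp \<and> f \<in> extensional (carrier \<Gamma>)}"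

definition upow :: "'a::comm_ring_1 \<Rightarrow> int \<Rightarrow> 'a" where
  "upow x m = (if m \<ge> 0 then x ^ nat m else (THE y. x * y = 1) ^ nat (- m))"

definition Q_set :: "('g, 'm) monoid_scheme \<Rightarrow> (int \<times> ('g \<Rightarrow> 'a::comm_ring_1)) set" where
  "Q_set \<Gamma> = UNIV \<times> Hom_mu \<Gamma>"

text \<open>(m,f) * (n,g) = (mn, m g + n f + f o d o g).\<close>
definition Q_mult :: "('g, 'm) monoid_scheme \<Rightarrow> ('g \<Rightarrow> 'a::comm_ring_1 set)
    \<Rightarrow> int \<times> ('g \<Rightarrow> 'a) \<Rightarrow> int \<times> ('g \<Rightarrow> 'a) \<Rightarrow> int \<times> ('g \<Rightarrow> 'a)" where
  "Q_mult \<Gamma> Rg p q = (case p of (m, f) \<Rightarrow> case q of (n, g) \<Rightarrow>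
     (m * n, restrict (\<lambda>\<gamma>. upow (g \<gamma>) m * upow (f \<gamma>) n * f (degree_map \<Gamma> Rg (g \<gamma>))) (carrier \<Gamma>)))"

definition Q_one :: "('g, 'm) monoid_scheme \<Rightarrow> int \<times> ('g \<Rightarrow> 'a::comm_ring_1)" where
  "Q_one \<Gamma> = (1, restrict (\<lambda>_. 1) (carrier \<Gamma>))"

text \<open>U*(d) = (1 + Hom(Gamma,mu)) intersected with the units of Q(d); an element 1+f is
  represented by f.\<close>
definition U_star :: "('g, 'm) monoid_scheme \<Rightarrow> ('g \<Rightarrow> 'a::comm_ring_1 set) \<Rightarrow> ('g \<Rightarrow> 'a) set" where
  "U_star \<Gamma> Rg = {f \<in> Hom_mu \<Gamma>. \<exists>q \<in> Q_set \<Gamma>.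
      Q_mult \<Gamma> Rg (1, f) q = Q_one \<Gamma> \<and> Q_mult \<Gamma> Rg q (1, f) = Q_one \<Gamma>}"

definition components :: "('g, 'm) monoid_scheme \<Rightarrow> ('g \<Rightarrow> 'a::comm_ring_1 set) \<Rightarrow> 'a \<Rightarrow> 'g \<Rightarrow> 'a" where
  "components \<Gamma> Rg x = (THE c. (\<forall>\<gamma>. \<gamma> \<notin> carrier \<Gamma> \<longrightarrow> c \<gamma> = 0) \<and> (\<forall>\<gamma>\<in>carrier \<Gamma>. c \<gamma> \<in> Rg \<gamma>)
        \<and> finite {\<gamma>. c \<gamma> \<noteq> 0} \<and> x = sum c {\<gamma>. c \<gamma> \<noteq> 0})"

definition U_act :: "('g, 'm) monoid_scheme \<Rightarrow> ('g \<Rightarrow> 'a::comm_ring_1 set) \<Rightarrow> ('g \<Rightarrow> 'a) \<Rightarrow> 'a \<Rightarrow> 'a" where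
  "U_act \<Gamma> Rg f x = (let c = components \<Gamma> Rg x in \<Sum>\<gamma>\<in>{\<gamma>. c \<gamma> \<noteq> 0}. f \<gamma> * c \<gamma>)"

definition U_act_D :: "('g, 'm) monoid_scheme \<Rightarrow> ('g \<Rightarrow> 'a::comm_ring_1 set) \<Rightarrow> ('g \<Rightarrow> 'a)
    \<Rightarrow> 'a set \<times> 'a set \<Rightarrow> 'a set \<times> 'a set" where
  "U_act_D \<Gamma> Rg f P = (U_act \<Gamma> Rg f ` fst P, U_act \<Gamma> Rg f ` snd P)"

end

theory Submission
  imports Defs "HOL-Algebra.Generated_Groups" "HOL-Algebra.Multiplicative_Group"
    "HOL-Library.Countable_Set"
begin

text \<open>
  A pair \<open>(A, G)\<close> in \<open>\<D>(R)\<close> grades \<open>R\<close> by \<open>G\<close>, so universality yields a homomorphism \<open>e\<close>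
  from \<open>\<Gamma>\<close> to \<open>G\<close> with \<open>A = \<Oplus>R\<^sub>\<gamma>\<close> over the kernel of \<open>e\<close>. Elements of \<open>G\<close> are homogeneous:
  universality applied to the grading of \<open>R = A[G]\<close> by the pieces \<open>R\<^sub>\<kappa>g\<close> makes each component
  of \<open>g\<close> a multiple of \<open>g\<close> by an element of \<open>R\<^sub>1\<close>, and these multipliers are orthogonal
  idempotents of the connected ring \<open>R\<close>. Hence \<open>e d e = e\<close>, that is, \<open>e\<close> is an idempotent of
  the ring \<open>Hom(\<Gamma>, \<mu>)\<close>; starkness of \<open>A\<close> says that \<open>1 - e\<close> dominates no nonzero idempotent.
  For two such \<open>e\<close>, \<open>e'\<close>, a Fitting argument makes \<open>e d e' d\<close> bijective on \<open>G\<close>, so there is an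
  idempotent with the kernel of \<open>e\<close> and the image of \<open>e'\<close>. Two idempotents \<open>e\<close>, \<open>g\<close> with the
  same kernel, or the same image, satisfy \<open>(g - e)\<^sup>2 = 0\<close> and are conjugate under \<open>1 + (g - e)\<close>,
  respectively \<open>1 + (e - g)\<close>.
\<close>

section \<open>Graded rings\<close>

locale graded =
  fixes \<Gamma> :: "('g, 'm) monoid_scheme" (structure)
    and Rg :: "'g \<Rightarrow> 'a::comm_ring_1 set"
  assumes grading: "grading \<Gamma> Rg"
begin

sublocale comm_group \<Gamma>
  using grading by (simp add: grading_def)

abbreviation comp :: "'a \<Rightarrow> 'g \<Rightarrow> 'a" where
  "comp \<equiv> components \<Gamma> Rg"

definition part :: "'g set \<Rightarrow> 'a set" where
  "part P = {x. \<forall>\<gamma>. comp x \<gamma> \<noteq> 0 \<longrightarrow> \<gamma> \<in> P}"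

lemma zero_mem [simp]: "\<gamma> \<in> carrier \<Gamma> \<Longrightarrow> 0 \<in> Rg \<gamma>"
  using grading by (simp add: grading_def)

lemma diff_mem: "\<gamma> \<in> carrier \<Gamma> \<Longrightarrow> x \<in> Rg \<gamma> \<Longrightarrow> y \<in> Rg \<gamma> \<Longrightarrow> x - y \<in> Rg \<gamma>"
  using grading by (simp add: grading_def)

lemma add_mem: "\<gamma> \<in> carrier \<Gamma> \<Longrightarrow> x \<in> Rg \<gamma> \<Longrightarrow> y \<in> Rg \<gamma> \<Longrightarrow> x + y \<in> Rg \<gamma>"
  using diff_mem[of \<gamma> x "0 - y"] diff_mem[of \<gamma> 0 y] by simp

lemma mult_mem:
  "\<gamma> \<in> carrier \<Gamma> \<Longrightarrow> \<delta> \<in> carrier \<Gamma> \<Longrightarrow> x \<in> Rg \<gamma> \<Longrightarrow> y \<in> Rg \<delta> \<Longrightarrow> x * y \<in> Rg (\<gamma> \<otimes> \<delta>)"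
  using grading by (simp add: grading_def)

lemma comp_ex1:
  "\<exists>!c. (\<forall>\<gamma>. \<gamma> \<notin> carrier \<Gamma> \<longrightarrow> c \<gamma> = 0) \<and> (\<forall>\<gamma>\<in>carrier \<Gamma>. c \<gamma> \<in> Rg \<gamma>)
        \<and> finite {\<gamma>. c \<gamma> \<noteq> 0} \<and> x = sum c {\<gamma>. c \<gamma> \<noteq> 0}"
  using grading unfolding grading_def by blast

lemma comp_props:
  "(\<forall>\<gamma>. \<gamma> \<notin> carrier \<Gamma> \<longrightarrow> comp x \<gamma> = 0) \<and> (\<forall>\<gamma>\<in>carrier \<Gamma>. comp x \<gamma> \<in> Rg \<gamma>)
        \<and> finite {\<gamma>. comp x \<gamma> \<noteq> 0} \<and> x = sum (comp x) {\<gamma>. comp x \<gamma> \<noteq> 0}"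
  unfolding components_def by (rule theI'[OF comp_ex1])

lemma comp_carrier: "comp x \<gamma> \<noteq> 0 \<Longrightarrow> \<gamma> \<in> carrier \<Gamma>"
  using comp_props by blast

lemma comp_mem: "\<gamma> \<in> carrier \<Gamma> \<Longrightarrow> comp x \<gamma> \<in> Rg \<gamma>"
  using comp_props by blast

lemma finite_comp [simp]: "finite {\<gamma>. comp x \<gamma> \<noteq> 0}"
  using comp_props by blast

lemma sum_comp: "sum (comp x) {\<gamma>. comp x \<gamma> \<noteq> 0} = x"
  using comp_props by metis

lemma sum_comp_superset:
  assumes "finite T" "\<And>\<gamma>. comp x \<gamma> \<noteq> 0 \<Longrightarrow> \<gamma> \<in> T"
  shows "sum (comp x) T = x"
proof -
  have "sum (comp x) T = sum (comp x) {\<gamma>. comp x \<gamma> \<noteq> 0}"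
    using assms by (intro sum.mono_neutral_right) auto
  then show ?thesis
    by (simp add: sum_comp)
qed

text \<open>Uniqueness of the decomposition, with \<open>T\<close> any finite set containing the
  support, which spares computing the exact support in applications.\<close>

lemma comp_eqI:
  assumes "finite T" and "\<And>\<gamma>. c \<gamma> \<noteq> 0 \<Longrightarrow> \<gamma> \<in> T" and "\<And>\<gamma>. c \<gamma> \<noteq> 0 \<Longrightarrow> \<gamma> \<in> carrier \<Gamma> \<and> c \<gamma> \<in> Rg \<gamma>"
    and "x = sum c T"
  shows "comp x = c"
proof -
  have "sum c T = sum c {\<gamma>. c \<gamma> \<noteq> 0}"
    using assms by (intro sum.mono_neutral_right) auto
  moreover have "finite {\<gamma>. c \<gamma> \<noteq> 0}"
    using assms by (intro finite_subset[OF _ assms(1)]) auto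
  moreover have "\<forall>\<gamma>\<in>carrier \<Gamma>. c \<gamma> \<in> Rg \<gamma>"
    using assms(3) zero_mem by metis
  ultimately have "(\<forall>\<gamma>. \<gamma> \<notin> carrier \<Gamma> \<longrightarrow> c \<gamma> = 0) \<and> (\<forall>\<gamma>\<in>carrier \<Gamma>. c \<gamma> \<in> Rg \<gamma>)
        \<and> finite {\<gamma>. c \<gamma> \<noteq> 0} \<and> x = sum c {\<gamma>. c \<gamma> \<noteq> 0}"
    using assms by metis
  then show ?thesis
    using comp_ex1[of x] comp_props[of x] by blast
qed

lemma comp_add: "comp (x + y) = (\<lambda>\<gamma>. comp x \<gamma> + comp y \<gamma>)"
proof (rule comp_eqI)
  let ?T = "{\<gamma>. comp x \<gamma> \<noteq> 0} \<union> {\<gamma>. comp y \<gamma> \<noteq> 0}"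
  show "finite ?T" by simp
  show "\<gamma> \<in> ?T" if "comp x \<gamma> + comp y \<gamma> \<noteq> 0" for \<gamma>
    using that by auto
  show "\<gamma> \<in> carrier \<Gamma> \<and> comp x \<gamma> + comp y \<gamma> \<in> Rg \<gamma>" if "comp x \<gamma> + comp y \<gamma> \<noteq> 0" for \<gamma>
  proof -
    have "\<gamma> \<in> carrier \<Gamma>" using that comp_carrier by (metis add.right_neutral)
    then show ?thesis by (simp add: add_mem comp_mem)
  qed
  show "x + y = (\<Sum>\<gamma>\<in>?T. comp x \<gamma> + comp y \<gamma>)"
    by (simp add: sum.distrib sum_comp_superset)
qed

lemma comp_zero [simp]: "comp 0 = (\<lambda>_. 0)"
  by (rule comp_eqI[where T = "{}"]) auto

lemma comp_diff: "comp (x - y) = (\<lambda>\<gamma>. comp x \<gamma> - comp y \<gamma>)"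
  using comp_add[of "x - y" y] by (auto simp: fun_eq_iff)

lemma comp_sum: "comp (sum h I) \<gamma> = (\<Sum>i\<in>I. comp (h i) \<gamma>)"
  by (induction I rule: infinite_finite_induct) (auto simp: comp_add)

lemma comp_homogeneous:
  "\<gamma> \<in> carrier \<Gamma> \<Longrightarrow> x \<in> Rg \<gamma> \<Longrightarrow> comp x = (\<lambda>\<delta>. if \<delta> = \<gamma> then x else 0)"
  by (rule comp_eqI[where T = "{\<gamma>}"]) (auto split: if_splits)

lemma comp_inject: "comp x = comp y \<Longrightarrow> x = y"
  using sum_comp by metis

lemma degree_unique:
  "x \<noteq> 0 \<Longrightarrow> \<gamma> \<in> carrier \<Gamma> \<Longrightarrow> \<delta> \<in> carrier \<Gamma> \<Longrightarrow> x \<in> Rg \<gamma> \<Longrightarrow> x \<in> Rg \<delta> \<Longrightarrow> \<gamma> = \<delta>"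
  using comp_homogeneous[of \<gamma> x] comp_homogeneous[of \<delta> x] by metis

section \<open>Sums of homogeneous pieces over a set of degrees\<close>

lemma partI: "(\<And>\<gamma>. comp x \<gamma> \<noteq> 0 \<Longrightarrow> \<gamma> \<in> P) \<Longrightarrow> x \<in> part P"
  by (simp add: part_def)

lemma partD: "x \<in> part P \<Longrightarrow> comp x \<gamma> \<noteq> 0 \<Longrightarrow> \<gamma> \<in> P"
  by (simp add: part_def)

lemma part_diff: "x \<in> part P \<Longrightarrow> y \<in> part P \<Longrightarrow> x - y \<in> part P"
  by (simp add: part_def comp_diff) (metis diff_zero)

lemma part_zero [simp]: "0 \<in> part P"
  by (simp add: part_def)

lemma part_sum:
  assumes "\<And>i. i \<in> I \<Longrightarrow> h i \<in> part P"
  shows "sum h I \<in> part P"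
proof (rule partI)
  fix \<gamma> assume "comp (sum h I) \<gamma> \<noteq> 0"
  then obtain i where "i \<in> I" "comp (h i) \<gamma> \<noteq> 0"
    by (metis comp_sum sum.neutral)
  then show "\<gamma> \<in> P" using assms partD by blast
qed

lemma part_homogeneous: "\<gamma> \<in> carrier \<Gamma> \<Longrightarrow> x \<in> Rg \<gamma> \<Longrightarrow> \<gamma> \<in> P \<Longrightarrow> x \<in> part P"
  by (auto simp: part_def comp_homogeneous)

lemma part_carrier [simp]: "part (carrier \<Gamma>) = UNIV"
  by (auto intro: partI comp_carrier)

lemma part_mult:
  assumes x: "x \<in> part P" and y: "y \<in> part Q"
    and PQ: "\<And>\<gamma> \<delta>. \<gamma> \<in> carrier \<Gamma> \<Longrightarrow> \<delta> \<in> carrier \<Gamma> \<Longrightarrow> \<gamma> \<in> P \<Longrightarrow> \<delta> \<in> Q \<Longrightarrow> \<gamma> \<otimes> \<delta> \<in> S"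
  shows "x * y \<in> part S"
proof -
  have "x * y = (\<Sum>\<gamma>\<in>{\<gamma>. comp x \<gamma> \<noteq> 0}. \<Sum>\<delta>\<in>{\<gamma>. comp y \<gamma> \<noteq> 0}. comp x \<gamma> * comp y \<delta>)"
    by (metis sum_product sum_comp)
  also have "\<dots> \<in> part S"
  proof (intro part_sum)
    fix \<gamma> \<delta> assume "\<gamma> \<in> {\<gamma>. comp x \<gamma> \<noteq> 0}" "\<delta> \<in> {\<gamma>. comp y \<gamma> \<noteq> 0}"
    then have "\<gamma> \<in> carrier \<Gamma>" "\<delta> \<in> carrier \<Gamma>" "\<gamma> \<in> P" "\<delta> \<in> Q"
      using x y by (auto dest: comp_carrier partD)
    then show "comp x \<gamma> * comp y \<delta> \<in> part S"
      using PQ by (intro part_homogeneous[of "\<gamma> \<otimes> \<delta>"] mult_mem comp_mem) auto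
  qed
  finally show ?thesis .
qed

text \<open>The unit component of 1 acts as the identity on each homogeneous element, as comparing
  components in \<open>x = 1 * x\<close> shows. Applied to the components of 1 this gives
  \<open>comp 1 \<one> = 1\<close>.\<close>

lemma one_mem: "1 \<in> Rg \<one>"
proof -
  let ?u = "comp 1" and ?S = "{\<gamma>. comp 1 \<gamma> \<noteq> 0}"
  have *: "?u \<one> * x = x" if x: "x \<in> Rg \<delta>" "\<delta> \<in> carrier \<Gamma>" for x \<delta>
  proof -
    have "x = (\<Sum>\<gamma>\<in>?S. ?u \<gamma> * x)"
      by (metis sum_comp mult_1 sum_distrib_right)
    moreover have "x = comp x \<delta>"
      using x by (simp add: comp_homogeneous)
    ultimately have "x = comp (\<Sum>\<gamma>\<in>?S. ?u \<gamma> * x) \<delta>"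
      by simp
    also have "\<dots> = (\<Sum>\<gamma>\<in>?S. comp (?u \<gamma> * x) \<delta>)"
      by (rule comp_sum)
    \<comment> \<open>Multiplication by a component of degree \<open>\<gamma>\<close> shifts degree
      \<open>\<delta>\<close> to \<open>\<gamma> \<otimes> \<delta>\<close>, so only the unit degree
      contributes in degree \<open>\<delta>\<close>.\<close>
    also have "\<dots> = (\<Sum>\<gamma>\<in>?S. if \<gamma> = \<one> then ?u \<gamma> * x else 0)"
    proof (intro sum.cong refl)
      fix \<gamma> assume "\<gamma> \<in> ?S"
      then have \<gamma>: "\<gamma> \<in> carrier \<Gamma>" by (auto dest: comp_carrier)
      then have "?u \<gamma> * x \<in> Rg (\<gamma> \<otimes> \<delta>)" using x by (simp add: mult_mem comp_mem)
      then have "comp (?u \<gamma> * x) \<delta> = (if \<delta> = \<gamma> \<otimes> \<delta> then ?u \<gamma> * x else 0)"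
        by (subst comp_homogeneous[of "\<gamma> \<otimes> \<delta>"]) (use \<gamma> x in auto)
      moreover have "\<delta> = \<gamma> \<otimes> \<delta> \<longleftrightarrow> \<gamma> = \<one>"
        using \<gamma> x by (metis l_one one_closed right_cancel)
      ultimately show "comp (?u \<gamma> * x) \<delta> = (if \<gamma> = \<one> then ?u \<gamma> * x else 0)" by simp
    qed
    also have "\<dots> = ?u \<one> * x"
      by (auto simp: sum.delta)
    finally show ?thesis by simp
  qed
  have "?u \<one> = ?u \<one> * (\<Sum>\<gamma>\<in>?S. ?u \<gamma>)"
    by (simp add: sum_comp)
  also have "\<dots> = (\<Sum>\<gamma>\<in>?S. ?u \<gamma>)"
    unfolding sum_distrib_left
    by (intro sum.cong refl) (auto intro!: * comp_mem dest: comp_carrier)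
  finally show ?thesis
    using comp_mem[of \<one> 1] by (simp add: sum_comp)
qed

lemma part_subring:
  assumes "subgroup P \<Gamma>" "P \<subseteq> Q"
  shows "subring_of (part P) (part Q)"
  unfolding subring_of_def
proof (intro conjI ballI)
  show "part P \<subseteq> part Q" using assms by (auto simp: part_def)
  show "1 \<in> part P" using one_mem assms
    by (intro part_homogeneous[of \<one>]) (auto simp: subgroup.one_closed)
next
  fix x y assume "x \<in> part P" "y \<in> part P"
  then show "x - y \<in> part P" "x * y \<in> part P"
    using assms(1) by (auto intro: part_diff part_mult subgroup.m_closed)
qed

text \<open>By uniqueness of components, the only possible witness for membership in a pushforward
  is the component function. Universality thereby becomes a statement about supports.\<close>

lemma pushforward_eq: "pushforward \<Gamma> Rg f \<epsilon> = part {\<gamma>. f \<gamma> = \<epsilon>}"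
proof (intro Set.set_eqI iffI)
  fix x assume "x \<in> pushforward \<Gamma> Rg f \<epsilon>"
  then obtain c where c: "\<forall>\<gamma>. c \<gamma> \<noteq> 0 \<longrightarrow> \<gamma> \<in> carrier \<Gamma> \<and> f \<gamma> = \<epsilon>" "\<forall>\<gamma>\<in>carrier \<Gamma>. c \<gamma> \<in> Rg \<gamma>"
    "finite {\<gamma>. c \<gamma> \<noteq> 0}" "x = sum c {\<gamma>. c \<gamma> \<noteq> 0}"
    by (auto simp: pushforward_def)
  then have "comp x = c" by (intro comp_eqI[where T = "{\<gamma>. c \<gamma> \<noteq> 0}"]) auto
  then show "x \<in> part {\<gamma>. f \<gamma> = \<epsilon>}" using c by (auto simp: part_def)
next
  fix x assume "x \<in> part {\<gamma>. f \<gamma> = \<epsilon>}"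
  then show "x \<in> pushforward \<Gamma> Rg f \<epsilon>"
    unfolding pushforward_def using comp_props[of x]
    by (auto intro!: exI[of _ "comp x"] dest: partD)
qed

text \<open>Finitely many additive generators have finitely many components in all. Applied to the
  grading by \<open>G\<close> this bounds \<open>G\<close>; applied to \<Gamma> it supplies a finite
  set of degrees, whose generated subgroup is countable.\<close>

lemma finite_support:
  assumes "is_order TYPE('a)"
  shows "\<exists>F. finite F \<and> F \<subseteq> carrier \<Gamma> \<and> (\<forall>x. x \<in> part F)"
proof -
  from assms obtain n and b :: "nat \<Rightarrow> 'a" where
    nb: "\<And>x. \<exists>k::nat \<Rightarrow> int. x = (\<Sum>i<n. of_int (k i) * b i)"
    unfolding is_order_def by metis
  define F where "F = (\<Union>i<n. {\<gamma>. comp (b i) \<gamma> \<noteq> 0})"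
  have neg: "- x \<in> part F" if "x \<in> part F" for x
    using part_diff[OF part_zero that] by simp
  have add: "x + y \<in> part F" if "x \<in> part F" "y \<in> part F" for x y
    using part_diff[OF that(1) neg[OF that(2)]] by simp
  have "x \<in> part F" for x
  proof -
    obtain k :: "nat \<Rightarrow> int" where "x = (\<Sum>i<n. of_int (k i) * b i)"
      using nb by blast
    moreover have "of_int m * b i \<in> part F" if "i < n" for m i
    proof -
      have b: "b i \<in> part F" using that by (auto simp: part_def F_def)
      have nat: "of_nat j * b i \<in> part F" for j
        by (induction j) (auto simp: distrib_right intro: add b)
      show ?thesis
      proof (cases "m \<ge> 0")
        case True
        then have "(of_int m :: 'a) = of_nat (nat m)" by simp
        then show ?thesis using nat by simp
      next
        case False
        then have "(of_int m :: 'a) = - of_nat (nat (- m))" by simp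
        then show ?thesis using neg[OF nat[of "nat (- m)"]] by simp
      qed
    qed
    ultimately show ?thesis by (auto intro: part_sum)
  qed
  moreover have "finite F" "F \<subseteq> carrier \<Gamma>"
    by (auto simp: F_def dest: comp_carrier)
  ultimately show ?thesis by blast
qed

end

text \<open>Existence and uniqueness of finitely supported decompositions reduce to spanning and
  independence over finite sets: coefficients are extended by zero, and two decompositions are
  subtracted on the union of their supports.\<close>

lemma gradingI:
  fixes Rd :: "'e \<Rightarrow> 'a::comm_ring_1 set"
  assumes "comm_group \<Delta>"
    and zero: "\<And>\<delta>. \<delta> \<in> carrier \<Delta> \<Longrightarrow> 0 \<in> Rd \<delta>"
    and diff: "\<And>\<delta> x y. \<delta> \<in> carrier \<Delta> \<Longrightarrow> x \<in> Rd \<delta> \<Longrightarrow> y \<in> Rd \<delta> \<Longrightarrow> x - y \<in> Rd \<delta>"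
    and mult: "\<And>\<gamma> \<delta> x y. \<gamma> \<in> carrier \<Delta> \<Longrightarrow> \<delta> \<in> carrier \<Delta> \<Longrightarrow> x \<in> Rd \<gamma> \<Longrightarrow> y \<in> Rd \<delta>
        \<Longrightarrow> x * y \<in> Rd (\<gamma> \<otimes>\<^bsub>\<Delta>\<^esub> \<delta>)"
    and span: "\<And>x. \<exists>T c. finite T \<and> T \<subseteq> carrier \<Delta> \<and> (\<forall>\<delta>\<in>T. c \<delta> \<in> Rd \<delta>) \<and> x = sum c T"
    and indep: "\<And>T c. finite T \<Longrightarrow> T \<subseteq> carrier \<Delta> \<Longrightarrow> (\<And>\<delta>. \<delta> \<in> T \<Longrightarrow> c \<delta> \<in> Rd \<delta>) \<Longrightarrow> sum c T = 0
        \<Longrightarrow> \<forall>\<delta>\<in>T. c \<delta> = 0"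
  shows "grading \<Delta> Rd"
  unfolding grading_def
proof (intro conjI ballI allI)
  fix x :: 'a
  obtain T c where T: "finite T" "T \<subseteq> carrier \<Delta>" "\<forall>\<delta>\<in>T. c \<delta> \<in> Rd \<delta>" "x = sum c T"
    using span[of x] by (elim exE conjE)
  show "\<exists>!c. (\<forall>\<delta>. \<delta> \<notin> carrier \<Delta> \<longrightarrow> c \<delta> = 0) \<and> (\<forall>\<delta>\<in>carrier \<Delta>. c \<delta> \<in> Rd \<delta>)
        \<and> finite {\<delta>. c \<delta> \<noteq> 0} \<and> x = sum c {\<delta>. c \<delta> \<noteq> 0}"
  proof (rule ex_ex1I)
    let ?c = "\<lambda>\<delta>. if \<delta> \<in> T then c \<delta> else 0"
    have "sum c T = sum ?c T" by simp
    also have "\<dots> = sum ?c {\<delta>. ?c \<delta> \<noteq> 0}"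
      using T(1) by (intro sum.mono_neutral_right) auto
    finally show "\<exists>c. (\<forall>\<delta>. \<delta> \<notin> carrier \<Delta> \<longrightarrow> c \<delta> = 0) \<and> (\<forall>\<delta>\<in>carrier \<Delta>. c \<delta> \<in> Rd \<delta>)
        \<and> finite {\<delta>. c \<delta> \<noteq> 0} \<and> x = sum c {\<delta>. c \<delta> \<noteq> 0}"
      using T zero by (intro exI[of _ ?c]) auto
  next
    fix c d
    assume c: "(\<forall>\<delta>. \<delta> \<notin> carrier \<Delta> \<longrightarrow> c \<delta> = 0) \<and> (\<forall>\<delta>\<in>carrier \<Delta>. c \<delta> \<in> Rd \<delta>)
        \<and> finite {\<delta>. c \<delta> \<noteq> 0} \<and> x = sum c {\<delta>. c \<delta> \<noteq> 0}"
      and d: "(\<forall>\<delta>. \<delta> \<notin> carrier \<Delta> \<longrightarrow> d \<delta> = 0) \<and> (\<forall>\<delta>\<in>carrier \<Delta>. d \<delta> \<in> Rd \<delta>)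
        \<and> finite {\<delta>. d \<delta> \<noteq> 0} \<and> x = sum d {\<delta>. d \<delta> \<noteq> 0}"
    let ?T = "{\<delta>. c \<delta> \<noteq> 0} \<union> {\<delta>. d \<delta> \<noteq> 0}"
    have fin: "finite ?T" using c d by simp
    have sub: "?T \<subseteq> carrier \<Delta>" using c d by blast
    have "sum c ?T = x"
      using c fin by (subst sum.mono_neutral_right[of ?T "{\<delta>. c \<delta> \<noteq> 0}"]) auto
    moreover have "sum d ?T = x"
      using d fin by (subst sum.mono_neutral_right[of ?T "{\<delta>. d \<delta> \<noteq> 0}"]) auto
    ultimately have "(\<Sum>\<delta>\<in>?T. c \<delta> - d \<delta>) = 0"
      by (simp add: sum_subtractf)
    then have cd: "\<forall>\<delta>\<in>?T. c \<delta> - d \<delta> = 0"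
      using fin sub c d by (intro indep) (auto intro!: diff)
    show "c = d"
    proof
      fix \<delta> show "c \<delta> = d \<delta>"
        using bspec[OF cd, of \<delta>] by (cases "\<delta> \<in> ?T") simp_all
    qed
  qed
qed (fact assms(1) | erule zero | erule (2) diff | erule (3) mult)+

lemma (in graded) independent:
  assumes "finite T" "T \<subseteq> carrier \<Gamma>" "\<And>\<gamma>. \<gamma> \<in> T \<Longrightarrow> c \<gamma> \<in> Rg \<gamma>" "sum c T = 0" "\<gamma> \<in> T"
  shows "c \<gamma> = 0"
proof -
  have "0 = (\<Sum>\<delta>\<in>T. comp (c \<delta>) \<gamma>)"
    using comp_sum[of c T \<gamma>] assms(4) by simp
  also have "\<dots> = (\<Sum>\<delta>\<in>T. if \<delta> = \<gamma> then c \<delta> else 0)"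
    using assms by (intro sum.cong refl) (auto simp: comp_homogeneous subset_iff)
  finally show ?thesis using assms by simp
qed

text \<open>Universality speaks only of groups with elements of type \<open>nat\<close>. A countable
  group is first carried along an injection into \<open>nat\<close>, and the homomorphism obtained
  there is pulled back.\<close>

lemma universal_grading_countable:
  assumes U: "universal_grading \<Gamma> Rg" and E: "grading E Rd" and "countable (carrier E)"
  obtains f where "f \<in> hom \<Gamma> E" "\<And>\<epsilon>. \<epsilon> \<in> carrier E \<Longrightarrow> Rd \<epsilon> = pushforward \<Gamma> Rg f \<epsilon>"
proof -
  interpret E: graded E Rd by standard (rule E)
  obtain j :: "_ \<Rightarrow> nat" where j: "inj_on j (carrier E)"
    using assms(3) unfolding countable_def by blast
  define i where "i = inv_into (carrier E) j"
  have ij [simp]: "i (j x) = x" if "x \<in> carrier E" for x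
    using j that by (simp add: i_def)
  \<comment> \<open>\<open>N\<close> is \<open>E\<close> with its structure carried along
    \<open>j\<close>; on the carrier \<open>i\<close> undoes \<open>j\<close>.\<close>
  define N :: "nat monoid" where
    "N = \<lparr>carrier = j ` carrier E, mult = (\<lambda>a b. j (i a \<otimes>\<^bsub>E\<^esub> i b)), one = j \<one>\<^bsub>E\<^esub>\<rparr>"
  have N: "comm_group N"
  proof (rule comm_groupI)
    fix x assume "x \<in> carrier N"
    then obtain a where "a \<in> carrier E" "x = j a" by (auto simp: N_def)
    then show "\<exists>y\<in>carrier N. y \<otimes>\<^bsub>N\<^esub> x = \<one>\<^bsub>N\<^esub>"
      by (intro bexI[of _ "j (inv\<^bsub>E\<^esub> a)"]) (auto simp: N_def)
  qed (auto simp: N_def E.m_assoc intro!: arg_cong[where f = j] intro: E.m_comm)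
  have "grading N (\<lambda>n. Rd (i n))"
  proof (rule gradingI[OF N])
    fix x
    have "sum (E.comp x) {\<gamma>. E.comp x \<gamma> \<noteq> 0} = x" by (rule E.sum_comp)
    moreover have "(\<Sum>n\<in>j ` {\<gamma>. E.comp x \<gamma> \<noteq> 0}. E.comp x (i n)) = sum (E.comp x) {\<gamma>. E.comp x \<gamma> \<noteq> 0}"
      by (subst sum.reindex) (auto intro!: inj_on_subset[OF j] sum.cong dest: E.comp_carrier)
    ultimately show "\<exists>T c. finite T \<and> T \<subseteq> carrier N \<and> (\<forall>\<delta>\<in>T. c \<delta> \<in> Rd (i \<delta>)) \<and> x = sum c T"
      by (intro exI[of _ "j ` {\<gamma>. E.comp x \<gamma> \<noteq> 0}"] exI[of _ "\<lambda>n. E.comp x (i n)"])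
        (auto simp: N_def dest: E.comp_carrier intro!: E.comp_mem)
  next
    fix T c assume T: "finite T" "T \<subseteq> carrier N" "\<And>\<delta>. \<delta> \<in> T \<Longrightarrow> c \<delta> \<in> Rd (i \<delta>)" "sum c T = 0"
    have ji: "j (i n) = n" if "n \<in> T" for n
      using T(2) that by (auto simp: N_def)
    have "inj_on i T" by (metis ji inj_onI)
    moreover have "(\<Sum>n\<in>T. c (j (i n))) = sum c T"
      by (intro sum.cong) (auto simp: ji)
    ultimately have "(\<Sum>\<epsilon>\<in>i ` T. c (j \<epsilon>)) = 0"
      using T(4) by (simp add: sum.reindex)
    moreover have "i ` T \<subseteq> carrier E" using T(2) by (auto simp: N_def)
    ultimately have "c (j \<epsilon>) = 0" if "\<epsilon> \<in> i ` T" for \<epsilon>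
      using that T by (intro E.independent[of "i ` T" "\<lambda>\<epsilon>. c (j \<epsilon>)"]) (auto simp: ji)
    then show "\<forall>\<delta>\<in>T. c \<delta> = 0" by (metis image_eqI ji)
  qed (auto simp: N_def intro!: E.diff_mem E.mult_mem)
  then obtain f where f: "f \<in> hom \<Gamma> N" "\<forall>\<epsilon>\<in>carrier N. Rd (i \<epsilon>) = pushforward \<Gamma> Rg f \<epsilon>"
    using conjunct2[OF U[unfolded universal_grading_def], rule_format, of N "\<lambda>n. Rd (i n)"] by blast
  interpret \<Gamma>: graded \<Gamma> Rg
    by standard (use U in \<open>simp add: universal_grading_def\<close>)
  have "f \<gamma> \<in> j ` carrier E" if "\<gamma> \<in> carrier \<Gamma>" for \<gamma>
    using f(1) that by (auto simp: hom_def N_def)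
  then have f': "i (f \<gamma>) \<in> carrier E" "j (i (f \<gamma>)) = f \<gamma>" if "\<gamma> \<in> carrier \<Gamma>" for \<gamma>
    using that by (metis (no_types, lifting) ij imageE)+
  show ?thesis
  proof
    show "(\<lambda>\<gamma>. i (f \<gamma>)) \<in> hom \<Gamma> E"
    proof (intro homI f')
      fix x y assume "x \<in> carrier \<Gamma>" "y \<in> carrier \<Gamma>"
      moreover from this have "f (x \<otimes>\<^bsub>\<Gamma>\<^esub> y) = j (i (f x) \<otimes>\<^bsub>E\<^esub> i (f y))"
        using hom_mult[OF f(1)] by (simp add: N_def)
      ultimately show "i (f (x \<otimes>\<^bsub>\<Gamma>\<^esub> y)) = i (f x) \<otimes>\<^bsub>E\<^esub> i (f y)"
        by (simp add: f')
    qed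
    fix \<epsilon> assume \<epsilon>: "\<epsilon> \<in> carrier E"
    then have "Rd \<epsilon> = pushforward \<Gamma> Rg f (j \<epsilon>)"
      using f(2)[rule_format, of "j \<epsilon>"] by (simp add: N_def)
    moreover have "f \<gamma> = j \<epsilon> \<longleftrightarrow> i (f \<gamma>) = \<epsilon>" if "\<gamma> \<in> carrier \<Gamma>" for \<gamma>
      using f'[OF that] ij[OF \<epsilon>] by auto
    then have "pushforward \<Gamma> Rg f (j \<epsilon>) = pushforward \<Gamma> Rg (\<lambda>\<gamma>. i (f \<gamma>)) \<epsilon>"
      unfolding \<Gamma>.pushforward_eq \<Gamma>.part_def by (auto dest: \<Gamma>.comp_carrier)
    ultimately show "Rd \<epsilon> = pushforward \<Gamma> Rg (\<lambda>\<gamma>. i (f \<gamma>)) \<epsilon>"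
      by simp
  qed
qed

section \<open>Group ring decompositions\<close>

definition mult_grp :: "'a::comm_ring_1 set \<Rightarrow> 'a monoid" where
  "mult_grp G = \<lparr>carrier = G, mult = (*), one = 1\<rparr>"

lemma mult_grp_simps [simp]:
  "carrier (mult_grp G) = G" "x \<otimes>\<^bsub>mult_grp G\<^esub> y = x * y" "\<one>\<^bsub>mult_grp G\<^esub> = 1"
  by (simp_all add: mult_grp_def)

lemma comm_group_mult_grp: "unit_subgroup_of G S \<Longrightarrow> comm_group (mult_grp G)"
  unfolding unit_subgroup_of_def by (rule comm_groupI) (auto simp: ac_simps)

lemma subring_of_zero: "subring_of A S \<Longrightarrow> 0 \<in> A"
  unfolding subring_of_def by (metis diff_self)

lemma D_ofD:
  assumes "(A, G) \<in> D_of S"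
  shows "subring_of A S" "unit_subgroup_of G S"
  using assms by (auto simp: D_of_def)

lemma D_of_ex1:
  assumes "(A, G) \<in> D_of S" "x \<in> S"
  shows "\<exists>!c. (\<forall>g. c g \<in> A) \<and> (\<forall>g. c g \<noteq> 0 \<longrightarrow> g \<in> G)
        \<and> finite {g. c g \<noteq> 0} \<and> x = (\<Sum>g\<in>{g. c g \<noteq> 0}. c g * g)"
  using assms unfolding D_of_def by blast

lemma D_of_span:
  assumes "(A, G) \<in> D_of S" "x \<in> S"
  obtains T c where "finite T" "T \<subseteq> G" "\<And>g. c g \<in> A" "x = (\<Sum>g\<in>T. c g * g)"
proof -
  obtain c where "(\<forall>g. c g \<in> A) \<and> (\<forall>g. c g \<noteq> 0 \<longrightarrow> g \<in> G)
        \<and> finite {g. c g \<noteq> 0} \<and> x = (\<Sum>g\<in>{g. c g \<noteq> 0}. c g * g)"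
    using D_of_ex1[OF assms] by blast
  then show ?thesis using that[of "{g. c g \<noteq> 0}" c] by blast
qed

text \<open>Uniqueness of coefficients at the element 0: the family extended by zero outside
  \<open>T\<close> is compared with the zero family.\<close>

lemma D_of_independent:
  assumes "(A, G) \<in> DR" "finite T" "T \<subseteq> G" "\<And>g. g \<in> T \<Longrightarrow> c g \<in> A" "(\<Sum>g\<in>T. c g * g) = 0" "g \<in> T"
  shows "c g = 0"
proof -
  let ?c = "\<lambda>g. if g \<in> T then c g else 0"
  have 0: "0 \<in> A" using D_ofD(1)[OF assms(1)] by (rule subring_of_zero)
  have "(\<Sum>g\<in>T. c g * g) = (\<Sum>g\<in>T. ?c g * g)" by simp
  also have "\<dots> = (\<Sum>g\<in>{g. ?c g \<noteq> 0}. ?c g * g)"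
    using assms(2) by (intro sum.mono_neutral_right) auto
  finally have "0 = (\<Sum>g\<in>{g. ?c g \<noteq> 0}. ?c g * g)" using assms(5) by simp
  then have 1: "0 = (\<Sum>g\<in>{g. ?c g \<noteq> 0}. ?c g * g)" .
  define P where "P = (\<lambda>d. (\<forall>g. d g \<in> A) \<and> (\<forall>g. d g \<noteq> 0 \<longrightarrow> g \<in> G)
        \<and> finite {g. d g \<noteq> 0} \<and> 0 = (\<Sum>g\<in>{g. d g \<noteq> 0}. d g * g))"
  have "\<exists>!d. P d" unfolding P_def by (rule D_of_ex1[OF assms(1) UNIV_I])
  moreover have "P ?c" unfolding P_def
  proof (intro conjI)
    show "finite {g. ?c g \<noteq> 0}" using assms(2) by simp
    show "0 = (\<Sum>g\<in>{g. ?c g \<noteq> 0}. ?c g * g)" by (rule 1)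
  qed (use assms(3,4) 0 in auto)
  moreover have "P (\<lambda>_. 0)" by (simp add: P_def 0)
  ultimately have "?c = (\<lambda>_. 0)" by (metis (no_types))
  from fun_cong[OF this, of g] show ?thesis using assms(6) by simp
qed

lemma D_ofI:
  assumes A: "subring_of A S" and G: "unit_subgroup_of G S"
    and span: "\<And>x. x \<in> S \<Longrightarrow> \<exists>T c. finite T \<and> T \<subseteq> G \<and> (\<forall>g\<in>T. c g \<in> A) \<and> x = (\<Sum>g\<in>T. c g * g)"
    and indep: "\<And>T c. finite T \<Longrightarrow> T \<subseteq> G \<Longrightarrow> (\<And>g. g \<in> T \<Longrightarrow> c g \<in> A) \<Longrightarrow> (\<Sum>g\<in>T. c g * g) = 0
        \<Longrightarrow> \<forall>g\<in>T. c g = 0"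
  shows "(A, G) \<in> D_of S"
proof -
  have "\<exists>!c. (\<forall>g. c g \<in> A) \<and> (\<forall>g. c g \<noteq> 0 \<longrightarrow> g \<in> G)
        \<and> finite {g. c g \<noteq> 0} \<and> x = (\<Sum>g\<in>{g. c g \<noteq> 0}. c g * g)" if x: "x \<in> S" for x
  proof (rule ex_ex1I)
    obtain T c where T: "finite T" "T \<subseteq> G" "\<forall>g\<in>T. c g \<in> A" "x = (\<Sum>g\<in>T. c g * g)"
      using span[OF x] by (elim exE conjE)
    let ?c = "\<lambda>g. if g \<in> T then c g else 0"
    have "(\<Sum>g\<in>T. c g * g) = (\<Sum>g\<in>T. ?c g * g)" by simp
    also have "\<dots> = (\<Sum>g\<in>{g. ?c g \<noteq> 0}. ?c g * g)"
      using T(1) by (intro sum.mono_neutral_right) auto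
    finally show "\<exists>c. (\<forall>g. c g \<in> A) \<and> (\<forall>g. c g \<noteq> 0 \<longrightarrow> g \<in> G)
        \<and> finite {g. c g \<noteq> 0} \<and> x = (\<Sum>g\<in>{g. c g \<noteq> 0}. c g * g)"
      using T subring_of_zero[OF A] by (intro exI[of _ ?c]) auto
  next
    fix c d
    assume c: "(\<forall>g. c g \<in> A) \<and> (\<forall>g. c g \<noteq> 0 \<longrightarrow> g \<in> G)
        \<and> finite {g. c g \<noteq> 0} \<and> x = (\<Sum>g\<in>{g. c g \<noteq> 0}. c g * g)"
      and d: "(\<forall>g. d g \<in> A) \<and> (\<forall>g. d g \<noteq> 0 \<longrightarrow> g \<in> G)
        \<and> finite {g. d g \<noteq> 0} \<and> x = (\<Sum>g\<in>{g. d g \<noteq> 0}. d g * g)"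
    let ?T = "{g. c g \<noteq> 0} \<union> {g. d g \<noteq> 0}"
    have fin: "finite ?T" using c d by simp
    have "(\<Sum>g\<in>?T. c g * g) = x"
      using c fin by (subst sum.mono_neutral_right[of ?T "{g. c g \<noteq> 0}"]) auto
    moreover have "(\<Sum>g\<in>?T. d g * g) = x"
      using d fin by (subst sum.mono_neutral_right[of ?T "{g. d g \<noteq> 0}"]) auto
    ultimately have "(\<Sum>g\<in>?T. (c g - d g) * g) = 0"
      by (simp add: sum_subtractf left_diff_distrib)
    then have cd: "\<forall>g\<in>?T. c g - d g = 0"
      using fin c d A by (intro indep) (auto simp: subring_of_def)
    show "c = d"
    proof
      fix g show "c g = d g"
        using bspec[OF cd, of g] by (cases "g \<in> ?T") simp_all
    qed
  qed
  then have "\<forall>x\<in>S. \<exists>!c. (\<forall>g. c g \<in> A) \<and> (\<forall>g. c g \<noteq> 0 \<longrightarrow> g \<in> G)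
        \<and> finite {g. c g \<noteq> 0} \<and> x = (\<Sum>g\<in>{g. c g \<noteq> 0}. c g * g)" by (rule ballI)
  with A G show ?thesis unfolding D_of_def by blast
qed

text \<open>The group ring grading, with \<open>A g\<close> in degree \<open>g\<close>. Universality
  applied to it produces the homomorphism from \<Gamma> to \<open>G\<close>.\<close>

lemma D_of_grading:
  assumes AG: "(A, G) \<in> DR"
  shows "grading (mult_grp G) (\<lambda>g. (\<lambda>a. a * g) ` A)"
proof (rule gradingI)
  note A = D_ofD(1)[OF AG] and G = D_ofD(2)[OF AG]
  show "comm_group (mult_grp G)" using G by (rule comm_group_mult_grp)
  show "0 \<in> (\<lambda>a. a * g) ` A" for g
    using subring_of_zero[OF A] by (auto intro!: image_eqI[of _ _ 0])
  show "x - y \<in> (\<lambda>a. a * g) ` A" if "x \<in> (\<lambda>a. a * g) ` A" "y \<in> (\<lambda>a. a * g) ` A" for x y g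
    using A that by (force simp: subring_of_def left_diff_distrib[symmetric])
  show "x * y \<in> (\<lambda>a. a * (g \<otimes>\<^bsub>mult_grp G\<^esub> h)) ` A"
    if xy: "x \<in> (\<lambda>a. a * g) ` A" "y \<in> (\<lambda>a. a * h) ` A" for x y g h
  proof -
    obtain a b where "a \<in> A" "b \<in> A" "x = a * g" "y = b * h" using xy by blast
    moreover from this have "a * b \<in> A" using A by (simp add: subring_of_def)
    ultimately show ?thesis by (auto intro!: image_eqI[of _ _ "a * b"] simp: ac_simps)
  qed
  show "\<exists>T c. finite T \<and> T \<subseteq> carrier (mult_grp G) \<and> (\<forall>\<delta>\<in>T. c \<delta> \<in> (\<lambda>a. a * \<delta>) ` A) \<and> x = sum c T" for x
  proof -
    obtain T c where "finite T" "T \<subseteq> G" "\<And>g. c g \<in> A" "x = (\<Sum>g\<in>T. c g * g)"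
      using D_of_span[OF AG UNIV_I, of x] by blast
    then show ?thesis
      by (intro exI[of _ T] exI[of _ "\<lambda>g. c g * g"]) auto
  qed
  fix T c assume T: "finite T" "T \<subseteq> carrier (mult_grp G)" "\<And>\<delta>. \<delta> \<in> T \<Longrightarrow> c \<delta> \<in> (\<lambda>a. a * \<delta>) ` A" "sum c T = 0"
  then have "\<forall>\<delta>\<in>T. \<exists>a. a \<in> A \<and> c \<delta> = a * \<delta>" by auto
  then obtain a where a: "\<And>\<delta>. \<delta> \<in> T \<Longrightarrow> a \<delta> \<in> A \<and> c \<delta> = a \<delta> * \<delta>" by metis
  then have "(\<Sum>\<delta>\<in>T. a \<delta> * \<delta>) = 0" using T(4) by (metis (no_types, lifting) sum.cong)
  then have "a \<delta> = 0" if "\<delta> \<in> T" for \<delta>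
    using that T a by (intro D_of_independent[OF AG, of T a]) auto
  then show "\<forall>\<delta>\<in>T. c \<delta> = 0" using a by simp
qed

section \<open>A finer grading of the group ring\<close>

lemma comm_group_DirProd:
  assumes "comm_group G" "comm_group H"
  shows "comm_group (G \<times>\<times> H)"
proof -
  interpret G: comm_group G by fact
  interpret H: comm_group H by fact
  show ?thesis
    by (rule group.group_comm_groupI[OF DirProd_group])
      (auto intro: G.m_comm H.m_comm G.group_axioms H.group_axioms)
qed

text \<open>Elements of the generated subgroup are values of words, encoded as lists of pairs whose
  boolean tells a generator (\<open>True\<close>) from the inverse of one (\<open>False\<close>).
  Lists over a countable set are countable.\<close>

lemma (in group) countable_generate:
  assumes "countable S" "S \<subseteq> carrier G"
  shows "countable (generate G S)"
proof -
  let ?f = "\<lambda>l. foldr (\<lambda>p. (\<otimes>) (if fst p then snd p else inv (snd p))) l \<one>"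
  let ?S = "UNIV \<times> S"
  have closed: "?f l \<in> carrier G" if "l \<in> lists ?S" for l
    using that assms(2) by (induction l) auto
  have app: "?f (l @ m) = ?f l \<otimes> ?f m" if "l \<in> lists ?S" "m \<in> lists ?S" for l m
    using that(1)
  proof (induction l)
    case Nil
    then show ?case using closed[OF that(2)] by simp
  next
    case (Cons p l)
    moreover from this have "(if fst p then snd p else inv (snd p)) \<in> carrier G"
      using assms(2) by auto
    ultimately show ?case
      using closed[of l] closed[OF that(2)] by (simp add: m_assoc del: if_split split del: if_split)
  qed
  have "generate G S \<subseteq> ?f ` lists ?S"
  proof
    fix x assume "x \<in> generate G S"
    then show "x \<in> ?f ` lists ?S"
    proof induction
      case one
      then show ?case by (intro image_eqI[of _ _ "[]"]) auto
    next
      case (incl h)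
      then show ?case using assms(2) by (intro image_eqI[of _ _ "[(True, h)]"]) auto
    next
      case (inv h)
      then show ?case using assms(2) by (intro image_eqI[of _ _ "[(False, h)]"]) auto
    next
      case (eng x y)
      then obtain l m where lm: "l \<in> lists ?S" "m \<in> lists ?S" "x = ?f l" "y = ?f m" by blast
      then show ?case by (intro image_eqI[of _ _ "l @ m"]) (auto simp only: app append_in_lists_conv)
    qed
  qed
  moreover have "countable (?f ` lists ?S)"
    using assms(1) by (intro countable_image countable_lists countable_SIGMA) auto
  ultimately show ?thesis by (rule countable_subset)
qed

text \<open>The ring \<open>part K\<close> is itself graded by \<open>K\<close>, and this is
  combined with the group ring grading. The piece at \<open>(\<one>, g)\<close> is what later
  controls the components of \<open>g\<close>.\<close>

lemma (in graded) grading_by_product: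
  assumes K: "subgroup K \<Gamma>" and AG: "(part K, G) \<in> DR"
  shows "grading (\<Gamma>\<lparr>carrier := K\<rparr> \<times>\<times> mult_grp G) (\<lambda>(\<kappa>, g). (\<lambda>x. x * g) ` Rg \<kappa>)"
proof (rule gradingI)
  note G = D_ofD(2)[OF AG]
  have KG: "K \<subseteq> carrier \<Gamma>" using K by (rule subgroup.subset)
  let ?E = "\<Gamma>\<lparr>carrier := K\<rparr> \<times>\<times> mult_grp G" and ?R = "\<lambda>(\<kappa>, g). (\<lambda>x. x * g) ` Rg \<kappa>"
  have "comm_group (\<Gamma>\<lparr>carrier := K\<rparr>)"
    using KG by (intro group.group_comm_groupI subgroup.subgroup_is_group[OF K is_group]) (auto intro: m_comm)
  then show "comm_group ?E"
    by (intro comm_group_DirProd comm_group_mult_grp[OF G])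
  show "0 \<in> ?R p" if "p \<in> carrier ?E" for p
    using that KG by (auto intro!: image_eqI[of _ _ 0])
  show "x - y \<in> ?R p" if "p \<in> carrier ?E" "x \<in> ?R p" "y \<in> ?R p" for p x y
  proof -
    obtain \<kappa> g where p: "p = (\<kappa>, g)" by fastforce
    then obtain a b where "a \<in> Rg \<kappa>" "b \<in> Rg \<kappa>" "x = a * g" "y = b * g" using \<open>x \<in> _\<close> \<open>y \<in> _\<close> by auto
    then show ?thesis
      using that(1) KG p by (auto intro!: image_eqI[of _ _ "a - b"] diff_mem simp: left_diff_distrib)
  qed
  show "x * y \<in> ?R (p \<otimes>\<^bsub>?E\<^esub> q)"
    if "p \<in> carrier ?E" "q \<in> carrier ?E" "x \<in> ?R p" "y \<in> ?R q" for p q x y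
  proof -
    obtain \<kappa> g \<nu> h where p: "p = (\<kappa>, g)" "q = (\<nu>, h)" by fastforce
    then obtain a b where "a \<in> Rg \<kappa>" "b \<in> Rg \<nu>" "x = a * g" "y = b * h" using \<open>x \<in> _\<close> \<open>y \<in> _\<close> by auto
    then show ?thesis
      using that(1,2) KG p by (auto intro!: image_eqI[of _ _ "a * b"] mult_mem simp: ac_simps)
  qed
  show "\<exists>T c. finite T \<and> T \<subseteq> carrier ?E \<and> (\<forall>p\<in>T. c p \<in> ?R p) \<and> x = sum c T" for x
  proof -
    obtain T c where T: "finite T" "T \<subseteq> G" "\<And>g. c g \<in> part K" "x = (\<Sum>g\<in>T. c g * g)"
      using D_of_span[OF AG UNIV_I, of x] by blast
    \<comment> \<open>One finite set of degrees serves all coefficients, so that the double sum runs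
      over a rectangle and its order can be exchanged.\<close>
    let ?S = "\<Union>g\<in>T. {\<gamma>. comp (c g) \<gamma> \<noteq> 0}"
    have fin: "finite ?S" using T(1) by simp
    have SK: "?S \<subseteq> K" using T(3) by (auto dest: partD)
    have "x = (\<Sum>g\<in>T. (\<Sum>\<kappa>\<in>?S. comp (c g) \<kappa>) * g)"
      unfolding T(4) using fin by (intro sum.cong refl arg_cong2[where f = "(*)"] sum_comp_superset[symmetric]) auto
    also have "\<dots> = (\<Sum>\<kappa>\<in>?S. \<Sum>g\<in>T. comp (c g) \<kappa> * g)"
      unfolding sum_distrib_right by (rule sum.swap)
    also have "\<dots> = (\<Sum>p\<in>?S \<times> T. comp (c (snd p)) (fst p) * snd p)"
      by (simp add: sum.cartesian_product case_prod_beta)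
    finally show ?thesis
      using T(1,2) fin SK KG
      by (intro exI[of _ "?S \<times> T"] exI[of _ "\<lambda>p. comp (c (snd p)) (fst p) * snd p"])
        (auto intro!: imageI comp_mem)
  qed
  fix T c assume T: "finite T" "T \<subseteq> carrier ?E" "\<And>p. p \<in> T \<Longrightarrow> c p \<in> ?R p" "sum c T = 0"
  have "\<forall>p\<in>T. \<exists>x. x \<in> Rg (fst p) \<and> c p = x * snd p" using T(3) by fastforce
  then obtain r where r: "\<And>p. p \<in> T \<Longrightarrow> r p \<in> Rg (fst p) \<and> c p = r p * snd p" by metis
  \<comment> \<open>Extension by zero to the rectangle \<open>?T1 \<times> ?T2\<close>. Independence
    over \<open>G\<close> with coefficients in \<open>part K\<close> is then followed by
    independence of the pieces \<open>Rg \<kappa>\<close>.\<close>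
  let ?r = "\<lambda>\<kappa> g. if (\<kappa>, g) \<in> T then r (\<kappa>, g) else 0"
  let ?T1 = "fst ` T" and ?T2 = "snd ` T"
  have sub: "?T1 \<subseteq> K" "?T2 \<subseteq> G" using T(2) by auto
  have r_mem: "?r \<kappa> g \<in> Rg \<kappa>" if "\<kappa> \<in> ?T1" for \<kappa> g
  proof -
    have "\<kappa> \<in> carrier \<Gamma>" using that sub KG by blast
    then show ?thesis using r[of "(\<kappa>, g)"] by auto
  qed
  have "(\<Sum>g\<in>?T2. (\<Sum>\<kappa>\<in>?T1. ?r \<kappa> g) * g) = (\<Sum>\<kappa>\<in>?T1. \<Sum>g\<in>?T2. ?r \<kappa> g * g)"
    unfolding sum_distrib_right by (rule sum.swap)
  also have "\<dots> = (\<Sum>p\<in>?T1 \<times> ?T2. ?r (fst p) (snd p) * snd p)"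
    unfolding sum.cartesian_product by (intro sum.cong) auto
  also have "\<dots> = (\<Sum>p\<in>T. ?r (fst p) (snd p) * snd p)"
    using T(1) by (intro sum.mono_neutral_right) (auto intro: rev_image_eqI)
  also have "\<dots> = 0"
    using r by (subst T(4)[symmetric], intro sum.cong) auto
  finally have *: "(\<Sum>g\<in>?T2. (\<Sum>\<kappa>\<in>?T1. ?r \<kappa> g) * g) = 0" .
  have **: "(\<Sum>\<kappa>\<in>?T1. ?r \<kappa> g) = 0" if "g \<in> ?T2" for g
  proof (rule D_of_independent[OF AG _ sub(2) _ * that])
    show "(\<Sum>\<kappa>\<in>?T1. ?r \<kappa> g) \<in> part K" for g
    proof (rule part_sum)
      fix \<kappa> assume "\<kappa> \<in> ?T1"
      then have "\<kappa> \<in> carrier \<Gamma>" "?r \<kappa> g \<in> Rg \<kappa>" "\<kappa> \<in> K" using r_mem sub KG by blast+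
      then show "?r \<kappa> g \<in> part K" by (rule part_homogeneous)
    qed
  qed (use T(1) in simp)
  have "?r \<kappa> g = 0" if "\<kappa> \<in> ?T1" "g \<in> ?T2" for \<kappa> g
  proof (rule independent[OF _ _ _ **[OF that(2)] that(1)])
    show "?T1 \<subseteq> carrier \<Gamma>" using sub KG by blast
    show "?r \<nu> g \<in> Rg \<nu>" if "\<nu> \<in> ?T1" for \<nu> using r_mem[OF that] .
  qed (use T(1) in simp)
  then show "\<forall>p\<in>T. c p = 0" using r by (force split: if_splits)
qed

text \<open>The elements \<open>comp g \<gamma> * h\<close> are orthogonal idempotents with sum 1.\<close>

lemma (in graded) homogeneous_unit:
  assumes connected: "\<And>e::'a. e * e = e \<Longrightarrow> e = 0 \<or> e = 1"
    and gh: "g * h = 1" and multiple: "\<And>\<gamma>. comp g \<gamma> \<in> (\<lambda>x. x * g) ` Rg \<one>"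
  shows "\<exists>\<gamma>\<in>carrier \<Gamma>. g \<in> Rg \<gamma>"
proof -
  define s where "s = (\<lambda>\<gamma>. comp g \<gamma> * h)"
  have s_mem: "s \<gamma> \<in> Rg \<one>" for \<gamma>
  proof -
    obtain x where "x \<in> Rg \<one>" "comp g \<gamma> = x * g" using multiple by blast
    moreover from this have "s \<gamma> = x * (g * h)" by (simp add: s_def mult.assoc)
    ultimately show ?thesis by (simp add: gh)
  qed
  have s_comp: "s \<gamma> * comp g \<delta> \<in> Rg \<delta>" if "\<delta> \<in> carrier \<Gamma>" for \<gamma> \<delta>
    using mult_mem[OF one_closed that s_mem comp_mem[OF that]] that by simp
  have orth: "s \<gamma> * s \<delta> = 0" if "\<gamma> \<noteq> \<delta>" for \<gamma> \<delta>
  proof (cases "\<gamma> \<in> carrier \<Gamma> \<and> \<delta> \<in> carrier \<Gamma>")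
    case True
    \<comment> \<open>Both sides are the product of two components with \<open>h\<close>. The left
      one lies in \<open>Rg \<delta>\<close>, the right one in \<open>Rg \<gamma>\<close>, so for
      distinct degrees they vanish.\<close>
    have "s \<gamma> * comp g \<delta> = s \<delta> * comp g \<gamma>" by (simp add: s_def ac_simps)
    then have "s \<gamma> * comp g \<delta> = 0"
      using s_comp[of \<delta> \<gamma>] s_comp[of \<gamma> \<delta>] True that degree_unique[of _ \<gamma> \<delta>] by metis
    then show ?thesis by (simp add: s_def ac_simps)
  next
    case False
    then have "comp g \<gamma> = 0 \<or> comp g \<delta> = 0" using comp_carrier by blast
    then show ?thesis by (auto simp: s_def)
  qed
  let ?S = "{\<gamma>. comp g \<gamma> \<noteq> 0}"
  have sum_s: "sum s ?S = 1"
    unfolding s_def sum_distrib_right[symmetric] sum_comp by (rule gh)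
  have "s \<gamma> * s \<gamma> = s \<gamma>" if "\<gamma> \<in> ?S" for \<gamma>
  proof -
    have "s \<gamma> = (\<Sum>\<delta>\<in>?S. s \<gamma> * s \<delta>)"
      by (simp add: sum_distrib_left[symmetric] sum_s)
    also have "\<dots> = (\<Sum>\<delta>\<in>?S. if \<delta> = \<gamma> then s \<gamma> * s \<gamma> else 0)"
      by (intro sum.cong refl) (auto simp: orth)
    finally show ?thesis using that by simp
  qed
  moreover obtain \<gamma> where \<gamma>: "\<gamma> \<in> ?S" "s \<gamma> \<noteq> 0"
    using sum_s by (metis (no_types, lifting) sum.neutral zero_neq_one)
  \<comment> \<open>A nonzero idempotent of a connected ring is 1, and
    \<open>comp g \<gamma> * h = 1\<close> means that the component is all of
    \<open>g\<close>.\<close>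
  ultimately have "s \<gamma> = 1" using connected by blast
  then have "comp g \<gamma> = g"
    using gh by (metis mult.assoc mult.commute mult_1 s_def)
  then show ?thesis using \<gamma> comp_mem[of \<gamma> g] comp_carrier[of g \<gamma>] by auto
qed

text \<open>Universality is used twice: the grading by \<open>G\<close> yields \<open>e\<close>, and
  the finer grading by \<open>K \<times> G\<close> makes the elements of \<open>G\<close>
  homogeneous through \<open>homogeneous_unit\<close>.\<close>

lemma (in graded) D_of_degree:
  assumes U: "universal_grading \<Gamma> Rg" and order: "is_order TYPE('a)"
    and connected: "\<And>e::'a. e * e = e \<Longrightarrow> e = 0 \<or> e = 1"
    and AG: "(A, G) \<in> DR"
  obtains e where "finite G" "e \<in> hom \<Gamma> (mult_grp G)" "A = part {\<gamma>. e \<gamma> = 1}"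
    "\<And>z. z \<in> G \<Longrightarrow> \<exists>\<gamma>\<in>carrier \<Gamma>. z \<in> Rg \<gamma> \<and> e \<gamma> = z"
proof -
  let ?Re = "\<lambda>g. (\<lambda>a. a * g) ` A"
  note A = D_ofD(1)[OF AG] and G = D_ofD(2)[OF AG]
  interpret S: graded "mult_grp G" ?Re
    by standard (rule D_of_grading[OF AG])
  obtain F where F: "finite F" "\<And>x. x \<in> S.part F" using S.finite_support[OF order] by blast
  have unit: "\<exists>h. g * h = 1" if "g \<in> G" for g
    using that G by (auto simp: unit_subgroup_of_def)
  have nz: "g \<noteq> 0" if "g \<in> G" for g using unit[OF that] by auto
  \<comment> \<open>Each \<open>g\<close> in \<open>G\<close> is its own nonzero component in degree
    \<open>g\<close>, so all of \<open>G\<close> occurs among the finitely many degrees.\<close>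
  have "G \<subseteq> F"
  proof
    fix g assume g: "g \<in> G"
    have "1 * g \<in> ?Re g" using A by (intro imageI) (simp add: subring_of_def)
    then have "S.comp g g = g" using g by (simp add: S.comp_homogeneous)
    then show "g \<in> F" using S.partD[OF F(2), of g g] nz[OF g] by simp
  qed
  then have finG: "finite G" using F(1) by (rule finite_subset)
  obtain e where e: "e \<in> hom \<Gamma> (mult_grp G)"
    and Re: "\<And>g. g \<in> G \<Longrightarrow> ?Re g = part {\<gamma>. e \<gamma> = g}"
    using universal_grading_countable[OF U S.grading] finG
    by (metis countable_finite mult_grp_simps(1) pushforward_eq)
  have A_eq: "A = part {\<gamma>. e \<gamma> = 1}"
    using Re[of 1] G by (simp add: unit_subgroup_of_def)
  obtain F where F: "finite F" "F \<subseteq> carrier \<Gamma>" "\<And>x. x \<in> part F"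
    using finite_support[OF order] by blast
  \<comment> \<open>All degrees that occur lie in \<open>F\<close>, so intersecting the kernel with
    \<open>generate \<Gamma> F\<close> does not change \<open>part\<close>, but it makes the group
    countable, as \<open>universal_grading_countable\<close> demands.\<close>
  define K where "K = generate \<Gamma> F \<inter> kernel \<Gamma> (mult_grp G) e"
  have K: "subgroup K \<Gamma>"
    unfolding K_def using e
    by (intro subgroups_Inter_pair generate_is_subgroup F group_hom.subgroup_kernel)
      (simp add: group_hom_def group_hom_axioms_def is_group S.is_group)
  have "countable K"
    unfolding K_def using countable_generate[of F] F by (auto intro: countable_finite)
  have A_K: "A = part K"
  proof (intro equalityI subsetI)
    fix x assume x: "x \<in> A"
    show "x \<in> part K"
    proof (rule partI)
      fix \<gamma> assume "comp x \<gamma> \<noteq> 0"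
      then show "\<gamma> \<in> K"
        using partD[OF F(3)] partD[of x "{\<gamma>. e \<gamma> = 1}"] x comp_carrier
        by (auto simp: K_def kernel_def A_eq intro: generate.incl)
    qed
  qed (auto simp: A_eq part_def K_def kernel_def)
  have grd: "grading (\<Gamma>\<lparr>carrier := K\<rparr> \<times>\<times> mult_grp G) (\<lambda>(\<kappa>, g). (\<lambda>x. x * g) ` Rg \<kappa>)"
    using K AG unfolding A_K by (rule grading_by_product)
  have "countable (carrier (\<Gamma>\<lparr>carrier := K\<rparr> \<times>\<times> mult_grp G))"
    using \<open>countable K\<close> finG by (simp add: countable_finite)
  then obtain f where f: "\<And>p. p \<in> carrier (\<Gamma>\<lparr>carrier := K\<rparr> \<times>\<times> mult_grp G) \<Longrightarrow>
      (case p of (\<kappa>, g) \<Rightarrow> (\<lambda>x. x * g) ` Rg \<kappa>) = part {\<gamma>. f \<gamma> = p}"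
    by (rule universal_grading_countable[OF U grd]) (unfold pushforward_eq, rule that)
  have "\<exists>\<gamma>\<in>carrier \<Gamma>. g \<in> Rg \<gamma> \<and> e \<gamma> = g" if g: "g \<in> G" for g
  proof -
    \<comment> \<open>This piece is a pushforward, hence contains the components of each of its
      elements. As \<open>g\<close> belongs to it, every component of \<open>g\<close> is a multiple
      of \<open>g\<close> by an element of \<open>Rg \<one>\<close>.\<close>
    have R1: "(\<lambda>x. x * g) ` Rg \<one> = part {\<gamma>. f \<gamma> = (\<one>, g)}"
      using f[of "(\<one>, g)"] g subgroup.one_closed[OF K] by simp
    have g1: "g \<in> (\<lambda>x. x * g) ` Rg \<one>"
      using one_mem by (intro image_eqI[of _ _ 1]) auto
    have "comp g \<gamma> \<in> (\<lambda>x. x * g) ` Rg \<one>" for \<gamma>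
    proof (cases "comp g \<gamma> = 0")
      case True
      then show ?thesis by (intro image_eqI[of _ _ 0]) auto
    next
      case False
      then have "\<gamma> \<in> carrier \<Gamma>" by (rule comp_carrier)
      moreover have "f \<gamma> = (\<one>, g)" using g1 False unfolding R1 by (auto dest: partD)
      ultimately show ?thesis
        unfolding R1 by (intro part_homogeneous[of \<gamma>] comp_mem) auto
    qed
    then obtain \<gamma> where \<gamma>: "\<gamma> \<in> carrier \<Gamma>" "g \<in> Rg \<gamma>"
      using homogeneous_unit[OF connected] unit[OF g] by blast
    \<comment> \<open>The degree found is sent to \<open>g\<close> by \<open>e\<close>, because
      \<open>g\<close> lies in \<open>A g\<close>, whose degrees form the fibre of \<open>e\<close>
      over \<open>g\<close>.\<close>
    have "1 * g \<in> ?Re g" using A by (intro imageI) (simp add: subring_of_def)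
    then have "g \<in> part {\<gamma>. e \<gamma> = g}" unfolding Re[OF g] by simp
    moreover have "comp g \<gamma> \<noteq> 0" using \<gamma> nz[OF g] by (simp add: comp_homogeneous)
    ultimately have "e \<gamma> = g" by (auto dest: partD)
    then show ?thesis using \<gamma> by blast
  qed
  then show ?thesis using that finG e A_eq by blast
qed

section \<open>Homogeneous roots of unity and the degree map\<close>

text \<open>The inverse of a unit in a commutative ring; the description is meaningful only when an
  inverse exists.\<close>

definition unit_inv :: "'a::comm_ring_1 \<Rightarrow> 'a" where
  "unit_inv x = (THE y. x * y = 1)"

lemma unit_inv_eqI:
  assumes "x * y = 1" shows "unit_inv x = y"
  unfolding unit_inv_def
proof (rule the_equality)
  show "x * y = 1" by fact
  fix z assume "x * z = 1"
  then have "y * (x * z) = y" by simp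
  then show "z = y" using assms by (simp add: mult.assoc[symmetric] mult.commute[of y x])
qed

context graded
begin

text \<open>The homogeneous roots of unity. On them \<open>degree_map\<close> picks a genuine degree
  by \<open>degree_unique\<close>, and they form a group on which it is a homomorphism.\<close>

definition hroots :: "'a set" where
  "hroots = {z \<in> roots_of_unity. \<exists>\<gamma>\<in>carrier \<Gamma>. z \<in> Rg \<gamma>}"

abbreviation deg :: "'a \<Rightarrow> 'g" where
  "deg \<equiv> degree_map \<Gamma> Rg"

text \<open>If \<open>z ^ n = 1\<close>, the inverse is \<open>z ^ (n - 1)\<close>, again a root of
  unity and homogeneous of degree \<open>\<gamma> [^] (n - 1)\<close>.\<close>

lemma hroots_inverse:
  assumes "z \<in> hroots" shows "\<exists>w\<in>hroots. z * w = 1"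
proof -
  obtain n \<gamma> where n: "n > 0" "z ^ n = 1" and \<gamma>: "\<gamma> \<in> carrier \<Gamma>" "z \<in> Rg \<gamma>"
    using assms by (auto simp: hroots_def roots_of_unity_def)
  have "z ^ k \<in> Rg (\<gamma> [^] k)" for k :: nat
  proof (induction k)
    case 0
    then show ?case using one_mem by simp
  next
    case (Suc k)
    then show ?case using mult_mem[of "\<gamma> [^] k" \<gamma> "z ^ k" z] \<gamma> by (simp add: mult.commute)
  qed
  moreover have "(z ^ (n - 1)) ^ n = 1"
    using n by (metis mult.commute power_mult power_one)
  ultimately have "z ^ (n - 1) \<in> hroots"
    using n \<gamma> by (auto simp: hroots_def roots_of_unity_def)
  moreover have "z * z ^ (n - 1) = 1"
    using n by (metis Suc_diff_1 power_Suc)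
  ultimately show ?thesis by blast
qed

lemma unit_inv_mem: "z \<in> hroots \<Longrightarrow> unit_inv z \<in> hroots"
  and unit_inv_right: "z \<in> hroots \<Longrightarrow> z * unit_inv z = 1"
  using hroots_inverse[of z] by (auto dest: unit_inv_eqI)

lemma unit_inv_left: "z \<in> hroots \<Longrightarrow> unit_inv z * z = 1"
  using unit_inv_right by (simp add: mult.commute)

lemma hroots_one: "1 \<in> hroots"
  using one_mem by (auto simp: hroots_def roots_of_unity_def)

lemma hroots_mult: "z \<in> hroots \<Longrightarrow> w \<in> hroots \<Longrightarrow> z * w \<in> hroots"
proof -
  assume z: "z \<in> hroots" and w: "w \<in> hroots"
  then obtain m n where mn: "m > 0" "z ^ m = 1" "n > 0" "w ^ n = 1"
    by (auto simp: hroots_def roots_of_unity_def)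
  have "(z * w) ^ (m * n) = (z ^ m) ^ n * (w ^ n) ^ m"
    by (simp add: power_mult_distrib power_mult[symmetric] mult.commute)
  then have "(z * w) ^ (m * n) = 1" using mn by simp
  moreover have "m * n > 0" using mn by simp
  ultimately have "z * w \<in> roots_of_unity" unfolding roots_of_unity_def by blast
  moreover have "\<exists>\<gamma>\<in>carrier \<Gamma>. z * w \<in> Rg \<gamma>"
    using z w mult_mem by (fastforce simp: hroots_def)
  ultimately show ?thesis by (simp add: hroots_def)
qed

lemma hroots_nonzero: "z \<in> hroots \<Longrightarrow> z \<noteq> 0"
  using unit_inv_right by fastforce

lemma hroots_cancel: "z \<in> hroots \<Longrightarrow> x * z = y * z \<Longrightarrow> x = y"
  by (metis mult.assoc mult.right_neutral unit_inv_right)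

lemma deg_eq: "z \<in> hroots \<Longrightarrow> \<gamma> \<in> carrier \<Gamma> \<Longrightarrow> z \<in> Rg \<gamma> \<Longrightarrow> deg z = \<gamma>"
  unfolding degree_map_def using degree_unique[OF hroots_nonzero] by (intro the_equality) blast+

lemma deg_closed: "z \<in> hroots \<Longrightarrow> deg z \<in> carrier \<Gamma>"
  and deg_mem: "z \<in> hroots \<Longrightarrow> z \<in> Rg (deg z)"
  using deg_eq[of z] by (auto simp: hroots_def)

lemma deg_mult: "z \<in> hroots \<Longrightarrow> w \<in> hroots \<Longrightarrow> deg (z * w) = deg z \<otimes> deg w"
  by (intro deg_eq hroots_mult mult_mem deg_mem m_closed deg_closed)

lemma deg_one: "deg 1 = \<one>"
  by (intro deg_eq hroots_one one_mem one_closed)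

lemma deg_unit_inv: "z \<in> hroots \<Longrightarrow> deg (unit_inv z) = inv (deg z)"
  using deg_mult[of "unit_inv z" z]
  by (simp add: unit_inv_left unit_inv_mem deg_one deg_closed inv_equality)

section \<open>Homomorphisms into the homogeneous roots of unity\<close>

abbreviation homs :: "('g \<Rightarrow> 'a) set" where
  "homs \<equiv> hom \<Gamma> (mult_grp hroots)"

lemma homs_mem: "f \<in> homs \<Longrightarrow> \<gamma> \<in> carrier \<Gamma> \<Longrightarrow> f \<gamma> \<in> hroots"
  by (auto simp: hom_def)

lemma homs_mult: "f \<in> homs \<Longrightarrow> \<gamma> \<in> carrier \<Gamma> \<Longrightarrow> \<delta> \<in> carrier \<Gamma> \<Longrightarrow> f (\<gamma> \<otimes> \<delta>) = f \<gamma> * f \<delta>"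
  by (auto simp: hom_def)

lemma homs_one: "f \<in> homs \<Longrightarrow> f \<one> = 1"
  using homs_mult[of f \<one> \<one>] hroots_cancel[OF homs_mem[of f \<one>], of "f \<one>" 1] by simp

lemma homs_inv: "f \<in> homs \<Longrightarrow> \<gamma> \<in> carrier \<Gamma> \<Longrightarrow> f (inv \<gamma>) = unit_inv (f \<gamma>)"
  using homs_mult[of f \<gamma> "inv \<gamma>"] by (intro unit_inv_eqI[symmetric]) (simp add: homs_one)

lemma subgroup_homs_kernel: "f \<in> homs \<Longrightarrow> subgroup {\<gamma> \<in> carrier \<Gamma>. f \<gamma> = 1} \<Gamma>"
proof (rule subgroupI)
  fix \<gamma> assume "f \<in> homs" "\<gamma> \<in> {\<gamma> \<in> carrier \<Gamma>. f \<gamma> = 1}"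
  then show "inv \<gamma> \<in> {\<gamma> \<in> carrier \<Gamma>. f \<gamma> = 1}"
    by (auto simp: homs_inv intro: unit_inv_eqI)
qed (auto simp: homs_one homs_mult)

lemma part_Collect_carrier: "part {\<gamma> \<in> carrier \<Gamma>. P \<gamma>} = part {\<gamma>. P \<gamma>}"
  by (auto simp: part_def dest: comp_carrier)

text \<open>With the degree map \<open>d\<close>, the condition \<open>f d f = f\<close> says that \<open>f\<close> is an idempotent of
  the ring \<open>Hom(\<Gamma>, \<mu>)\<close> with product \<open>f \<circ> d \<circ> g\<close>.\<close>

lemma idempotent_D_of:
  assumes f: "f \<in> homs" and idem: "\<And>\<gamma>. \<gamma> \<in> carrier \<Gamma> \<Longrightarrow> f (deg (f \<gamma>)) = f \<gamma>"
    and \<Delta>: "subgroup \<Delta> \<Gamma>" and stable: "\<And>\<gamma>. \<gamma> \<in> \<Delta> \<Longrightarrow> deg (f \<gamma>) \<in> \<Delta>"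
  shows "(part {\<gamma> \<in> \<Delta>. f \<gamma> = 1}, f ` \<Delta>) \<in> D_of (part \<Delta>)"
proof (rule D_ofI)
  have \<Delta>_sub: "\<gamma> \<in> carrier \<Gamma>" if "\<gamma> \<in> \<Delta>" for \<gamma>
    using that \<Delta> subgroup.subset by blast
  have f_mem: "f \<gamma> \<in> hroots" if "\<gamma> \<in> \<Delta>" for \<gamma>
    using f \<Delta>_sub[OF that] by (rule homs_mem)
  have "{\<gamma> \<in> \<Delta>. f \<gamma> = 1} = \<Delta> \<inter> {\<gamma> \<in> carrier \<Gamma>. f \<gamma> = 1}"
    using \<Delta>_sub by auto
  then have "subgroup {\<gamma> \<in> \<Delta>. f \<gamma> = 1} \<Gamma>"
    using subgroups_Inter_pair[OF \<Delta> subgroup_homs_kernel[OF f]] by simp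
  then show "subring_of (part {\<gamma> \<in> \<Delta>. f \<gamma> = 1}) (part \<Delta>)"
    by (rule part_subring) auto
  show "unit_subgroup_of (f ` \<Delta>) (part \<Delta>)"
    unfolding unit_subgroup_of_def
  proof (intro conjI ballI)
    show "f ` \<Delta> \<subseteq> part \<Delta>"
      using f_mem stable by (auto intro!: part_homogeneous[OF deg_closed deg_mem])
    show "1 \<in> f ` \<Delta>"
      using subgroup.one_closed[OF \<Delta>] homs_one[OF f] by (intro image_eqI[of _ _ \<one>]) auto
    fix x assume "x \<in> f ` \<Delta>"
    then obtain \<gamma> where \<gamma>: "\<gamma> \<in> \<Delta>" "x = f \<gamma>" by blast
    show "\<exists>y\<in>f ` \<Delta>. x * y = 1"
    proof
      show "f (inv \<gamma>) \<in> f ` \<Delta>" using \<gamma> \<Delta> by (intro imageI subgroup.m_inv_closed)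
      show "x * f (inv \<gamma>) = 1" using \<gamma> f_mem \<Delta>_sub by (simp add: homs_inv[OF f] unit_inv_right)
    qed
    fix y assume "y \<in> f ` \<Delta>"
    then obtain \<delta> where \<delta>: "\<delta> \<in> \<Delta>" "y = f \<delta>" by blast
    show "x * y \<in> f ` \<Delta>"
      using \<gamma> \<delta> \<Delta>_sub subgroup.m_closed[OF \<Delta>, of \<gamma> \<delta>]
      by (intro image_eqI[of _ _ "\<gamma> \<otimes> \<delta>"]) (auto simp: homs_mult[OF f])
  qed
  show "\<exists>T c. finite T \<and> T \<subseteq> f ` \<Delta> \<and> (\<forall>k\<in>T. c k \<in> part {\<gamma> \<in> \<Delta>. f \<gamma> = 1}) \<and> x = (\<Sum>k\<in>T. c k * k)"
    if x: "x \<in> part \<Delta>" for x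
  proof -
    let ?S = "{\<gamma>. comp x \<gamma> \<noteq> 0}"
    \<comment> \<open>The coefficient of \<open>k\<close> collects the components in the fibre over
      \<open>k\<close>, divided by \<open>k\<close>.\<close>
    let ?c = "\<lambda>k. \<Sum>\<gamma>\<in>{\<gamma>\<in>?S. f \<gamma> = k}. comp x \<gamma> * unit_inv k"
    have S: "\<gamma> \<in> \<Delta>" if "\<gamma> \<in> ?S" for \<gamma>
      using x that by (auto dest: partD)
    have "x = (\<Sum>k\<in>f ` ?S. \<Sum>\<gamma>\<in>{\<gamma>\<in>?S. f \<gamma> = k}. comp x \<gamma>)"
      using sum.image_gen[of ?S "comp x" f] by (simp add: sum_comp)
    also have "\<dots> = (\<Sum>k\<in>f ` ?S. ?c k * k)"
    proof (intro sum.cong refl)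
      fix k assume "k \<in> f ` ?S"
      then have "k \<in> hroots" using f_mem S by blast
      then show "(\<Sum>\<gamma>\<in>{\<gamma>\<in>?S. f \<gamma> = k}. comp x \<gamma>) = ?c k * k"
        by (simp add: sum_distrib_right mult.assoc unit_inv_left)
    qed
    finally have "x = (\<Sum>k\<in>f ` ?S. ?c k * k)" .
    moreover have "?c k \<in> part {\<gamma> \<in> \<Delta>. f \<gamma> = 1}" for k
    proof (rule part_sum)
      fix \<gamma> assume "\<gamma> \<in> {\<gamma>\<in>?S. f \<gamma> = k}"
      then have \<gamma>: "\<gamma> \<in> \<Delta>" "k = f \<gamma>" "k \<in> hroots" using S f_mem by auto
      then have d: "inv (deg k) \<in> \<Delta>" using stable \<Delta> by (auto intro: subgroup.m_inv_closed)
      \<comment> \<open>Dividing by \<open>k\<close> shifts the degree by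
        \<open>inv (deg k)\<close>, and \<open>f (deg k) = k\<close> by idempotence, so the new
        degree lies in the kernel.\<close>
      have "f (\<gamma> \<otimes> inv (deg k)) = 1"
        using \<gamma> \<Delta>_sub idem by (simp add: homs_mult[OF f] homs_inv[OF f] deg_closed unit_inv_right)
      moreover have "comp x \<gamma> * unit_inv k \<in> Rg (\<gamma> \<otimes> inv (deg k))"
        using \<gamma> \<Delta>_sub deg_mem[OF unit_inv_mem[of k]]
        by (intro mult_mem comp_mem) (auto simp: deg_unit_inv deg_closed)
      ultimately show "comp x \<gamma> * unit_inv k \<in> part {\<gamma> \<in> \<Delta>. f \<gamma> = 1}"
        using \<gamma> d \<Delta> \<Delta>_sub by (intro part_homogeneous[of "\<gamma> \<otimes> inv (deg k)"]) (auto intro: subgroup.m_closed)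
    qed
    ultimately show ?thesis
      using S by (intro exI[of _ "f ` ?S"] exI[of _ ?c]) auto
  qed
  fix T c assume T: "finite T" "T \<subseteq> f ` \<Delta>" "\<And>k. k \<in> T \<Longrightarrow> c k \<in> part {\<gamma> \<in> \<Delta>. f \<gamma> = 1}"
    "(\<Sum>k\<in>T. c k * k) = 0"
  have T_mem: "k \<in> hroots" "f (deg k) = k" if "k \<in> T" for k
    using that T(2) f_mem \<Delta>_sub idem by auto
  \<comment> \<open>Multiplication by \<open>k\<close> moves the kernel into the fibre over
    \<open>k\<close>. Different \<open>k\<close> therefore contribute disjoint sets of degrees,
    which gives independence.\<close>
  have ck: "c k * k \<in> part {\<gamma>. f \<gamma> = k}" if k: "k \<in> T" for k
  proof (rule part_mult)
    show "c k \<in> part {\<gamma>. f \<gamma> = 1}" using T(3)[OF k] by (auto simp: part_def)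
    show "k \<in> part {deg k}"
      using T_mem[OF k] by (intro part_homogeneous[OF deg_closed deg_mem]) auto
  qed (use T_mem[OF k] in \<open>auto simp: homs_mult[OF f]\<close>)
  show "\<forall>k\<in>T. c k = 0"
  proof
    fix k assume k: "k \<in> T"
    have "comp (c k * k) \<gamma> = 0" for \<gamma>
    proof (rule ccontr)
      assume *: "comp (c k * k) \<gamma> \<noteq> 0"
      then have "f \<gamma> = k" using partD[OF ck[OF k]] by blast
      have "0 = (\<Sum>l\<in>T. comp (c l * l) \<gamma>)"
        using T(4) comp_sum[of "\<lambda>l. c l * l" T \<gamma>] by simp
      also have "\<dots> = (\<Sum>l\<in>T. if l = k then comp (c k * k) \<gamma> else 0)"
      proof (intro sum.cong refl)
        fix l assume l: "l \<in> T"
        then show "comp (c l * l) \<gamma> = (if l = k then comp (c k * k) \<gamma> else 0)"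
          using partD[OF ck[OF l], of \<gamma>] \<open>f \<gamma> = k\<close> by (cases "l = k") auto
      qed
      finally show False using * k T(1) by simp
    qed
    then have "comp (c k * k) = comp (0 * k)" by (simp add: fun_eq_iff)
    then show "c k = 0" using comp_inject hroots_cancel[OF T_mem(1)[OF k]] by blast
  qed
qed

text \<open>The hypothesis \<open>ef\<close> places the degrees of all values of \<open>f\<close> in
  the kernel of \<open>e\<close>. So \<open>f\<close> restricts to that kernel and exhibits its
  \<open>part\<close> as a group ring over the image; starkness makes this image trivial, and
  \<open>f = f d f\<close> then makes \<open>f\<close> trivial.\<close>

lemma stark_idempotent:
  assumes e: "e \<in> homs" and stark: "stark (part {\<gamma>. e \<gamma> = 1})"
    and f: "f \<in> homs" and idem: "\<And>\<gamma>. \<gamma> \<in> carrier \<Gamma> \<Longrightarrow> f (deg (f \<gamma>)) = f \<gamma>"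
    and ef: "\<And>\<gamma>. \<gamma> \<in> carrier \<Gamma> \<Longrightarrow> e (deg (f \<gamma>)) = 1"
    and \<gamma>: "\<gamma> \<in> carrier \<Gamma>"
  shows "f \<gamma> = 1"
proof -
  let ?\<Delta> = "{\<gamma> \<in> carrier \<Gamma>. e \<gamma> = 1}"
  have d: "deg (f \<gamma>) \<in> ?\<Delta>" if "\<gamma> \<in> carrier \<Gamma>" for \<gamma>
    using that ef f by (auto intro: deg_closed homs_mem)
  have "(part {\<gamma> \<in> ?\<Delta>. f \<gamma> = 1}, f ` ?\<Delta>) \<in> D_of (part ?\<Delta>)"
    using d by (intro idempotent_D_of f idem subgroup_homs_kernel e) auto
  then have "f ` ?\<Delta> = {1}"
    using stark unfolding stark_def part_Collect_carrier by blast
  then have "f (deg (f \<gamma>)) = 1" using d[OF \<gamma>] by blast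
  then show ?thesis by (simp add: idem \<gamma>)
qed

end

section \<open>Comparing two maximal idempotents\<close>

lemma funpow_closed: "(\<And>z. z \<in> S \<Longrightarrow> x z \<in> S) \<Longrightarrow> z \<in> S \<Longrightarrow> (x ^^ n) z \<in> S"
  by (induction n) auto

text \<open>A finite set has finitely many self-maps, so the powers of \<open>x\<close> are
  eventually periodic; a large multiple of the period gives an idempotent power.\<close>

lemma funpow_idempotent:
  assumes S: "finite S" and x: "\<And>z. z \<in> S \<Longrightarrow> x z \<in> S"
  shows "\<exists>n>0. \<forall>z\<in>S. (x ^^ n) ((x ^^ n) z) = (x ^^ n) z"
proof -
  let ?r = "\<lambda>n. restrict (x ^^ n) S"
  have "range ?r \<subseteq> S \<rightarrow>\<^sub>E S"
    using funpow_closed[of S x] x by (intro image_subsetI PiE_I) auto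
  moreover have "finite (S \<rightarrow>\<^sub>E S)"
    using S by (simp add: finite_PiE)
  ultimately have "finite (range ?r)"
    by (rule finite_subset)
  then have "\<not> inj ?r"
    using finite_imageD[of ?r UNIV] infinite_UNIV_nat by blast
  then obtain i j where ij: "i < j" "?r i = ?r j"
    using linorder_injI[of ?r] by blast
  define p where "p = j - i"
  have p: "p > 0" "j = p + i" using ij by (auto simp: p_def)
  \<comment> \<open>The powers \<open>i\<close> and \<open>j\<close> agree on \<open>S\<close>, so
    from exponent \<open>i\<close> on they repeat with period \<open>p\<close>.\<close>
  have period: "(x ^^ (p * k + m)) z = (x ^^ m) z" if z: "z \<in> S" and m: "m \<ge> i" for k m z
  proof (induction k)
    case (Suc k)
    have *: "(x ^^ i) w = (x ^^ (p + i)) w" if "w \<in> S" for w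
      using fun_cong[OF ij(2), of w] p(2) that by simp
    let ?w = "(x ^^ (p * k + m - i)) z"
    have "?w \<in> S" using x z by (rule funpow_closed)
    have "(x ^^ (p * Suc k + m)) z = (x ^^ (p + i)) ?w"
    proof -
      have "p * Suc k + m = (p + i) + (p * k + m - i)" using m by simp
      then show ?thesis by (simp only: funpow_add o_apply)
    qed
    also have "\<dots> = (x ^^ i) ?w" using *[OF \<open>?w \<in> S\<close>] by simp
    also have "\<dots> = (x ^^ (p * k + m)) z"
    proof -
      have "p * k + m = i + (p * k + m - i)" using m by simp
      then show ?thesis by (metis funpow_add o_apply)
    qed
    finally show ?case using Suc by simp
  qed simp
  \<comment> \<open>A positive multiple of the period that is at least \<open>i\<close>, so doubling
    the exponent does not change the power.\<close>
  let ?n = "p * Suc i"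
  have "i \<le> ?n" using p(1) by (cases p) auto
  then have "(x ^^ (?n + ?n)) z = (x ^^ ?n) z" if "z \<in> S" for z
    using period[OF that] by blast
  moreover have "?n > 0" using p(1) by simp
  ultimately show ?thesis unfolding funpow_add o_apply by blast
qed

context graded
begin

text \<open>An idempotent of the ring of homomorphisms together with its image:
  \<open>e (deg z) = z\<close> on the image says \<open>e d e = e\<close>.\<close>

definition retraction :: "('g \<Rightarrow> 'a) \<Rightarrow> 'a set \<Rightarrow> bool" where
  "retraction e G \<longleftrightarrow> e \<in> homs \<and> G = e ` carrier \<Gamma> \<and> (\<forall>z\<in>G. e (deg z) = z)"

lemma retraction_homs: "retraction e G \<Longrightarrow> e \<in> homs"
  by (simp add: retraction_def)

lemma retraction_mem: "retraction e G \<Longrightarrow> \<gamma> \<in> carrier \<Gamma> \<Longrightarrow> e \<gamma> \<in> G"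
  by (simp add: retraction_def)

lemma retraction_deg: "retraction e G \<Longrightarrow> z \<in> G \<Longrightarrow> e (deg z) = z"
  by (simp add: retraction_def)

lemma retraction_subset: "retraction e G \<Longrightarrow> z \<in> G \<Longrightarrow> z \<in> hroots"
  by (auto simp: retraction_def intro: homs_mem)

lemma homs_deg_mult:
  "f \<in> homs \<Longrightarrow> z \<in> hroots \<Longrightarrow> w \<in> hroots \<Longrightarrow> f (deg (z * w)) = f (deg z) * f (deg w)"
  by (simp add: deg_mult homs_mult deg_closed)

lemma homs_deg_inv: "f \<in> homs \<Longrightarrow> z \<in> hroots \<Longrightarrow> f (deg (unit_inv z)) = unit_inv (f (deg z))"
  by (simp add: deg_unit_inv homs_inv deg_closed)

lemma homs_deg_one: "f \<in> homs \<Longrightarrow> f (deg 1) = 1"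
  by (simp add: deg_one homs_one)

lemma retraction_mult: "retraction e G \<Longrightarrow> z \<in> G \<Longrightarrow> w \<in> G \<Longrightarrow> z * w \<in> G"
  using retraction_mem[of e G "deg (z * w)"]
  by (simp add: homs_deg_mult retraction_homs retraction_deg retraction_subset deg_closed hroots_mult)

lemma retraction_one: "retraction e G \<Longrightarrow> 1 \<in> G"
  using retraction_mem[of e G \<one>] by (simp add: homs_one retraction_homs)

lemma retraction_inv: "retraction e G \<Longrightarrow> z \<in> G \<Longrightarrow> unit_inv z \<in> G"
  using retraction_mem[of e G "deg (unit_inv z)"]
  by (simp add: homs_deg_inv retraction_homs retraction_deg retraction_subset deg_closed unit_inv_mem)

lemma unit_inv_mult: "z \<in> hroots \<Longrightarrow> w \<in> hroots \<Longrightarrow> unit_inv (z * w) = unit_inv z * unit_inv w"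
proof (rule unit_inv_eqI)
  assume "z \<in> hroots" "w \<in> hroots"
  moreover have "z * w * (unit_inv z * unit_inv w) = (z * unit_inv z) * (w * unit_inv w)"
    by (simp only: ac_simps)
  ultimately show "z * w * (unit_inv z * unit_inv w) = 1"
    by (simp add: unit_inv_right)
qed

lemma unit_inv_one: "unit_inv 1 = (1::'a)"
  by (rule unit_inv_eqI) simp

text \<open>A Fitting argument: write \<open>x = e d e' d\<close> on \<open>G\<close> and let \<open>x^n\<close> be idempotent. The
  nilpotent part of \<open>x\<close> is the image of \<open>q = 1 - x^n\<close>, and \<open>T = q + xq + ... + x^(n-1)q\<close> inverts
  \<open>1 - x\<close> there. Then \<open>f = (1 - e'd)Te\<close> is an idempotent with \<open>e'df = 0\<close>, so \<open>f = 0\<close> and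
  \<open>q = edf = 0\<close>.\<close>

lemma fitting:
  assumes e: "retraction e G" and e': "retraction e' H" and "finite G"
    and stark: "stark (part {\<gamma>. e' \<gamma> = 1})"
  shows "\<exists>n>0. \<forall>z\<in>G. ((\<lambda>z. e (deg (e' (deg z)))) ^^ n) z = z"
proof -
  note eh = retraction_homs[OF e] and eh' = retraction_homs[OF e']
  note GM = retraction_subset[OF e]
  note G_mult = retraction_mult[OF e] and G_inv = retraction_inv[OF e] and G_one = retraction_one[OF e]
  define x where "x = (\<lambda>z. e (deg (e' (deg z))))"
  have x_mem: "x z \<in> G" if "z \<in> hroots" for z
    unfolding x_def using that by (intro retraction_mem[OF e] deg_closed homs_mem[OF eh'])
  have x_mult: "x (z * w) = x z * x w" if "z \<in> hroots" "w \<in> hroots" for z w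
    using that by (simp add: x_def homs_deg_mult eh eh' homs_mem deg_closed)
  have x_one: "x 1 = 1" by (simp add: x_def homs_deg_one eh eh')
  have pow_mem: "(x ^^ k) z \<in> G" if "z \<in> G" for z k
    using that x_mem GM by (intro funpow_closed) auto
  have pow_mult: "(x ^^ k) (z * w) = (x ^^ k) z * (x ^^ k) w" if "z \<in> G" "w \<in> G" for z w k
    using that by (induction k) (auto simp: x_mult GM pow_mem)
  have pow_one: "(x ^^ k) 1 = 1" for k by (induction k) (auto simp: x_one)
  have pow_inv: "(x ^^ k) (unit_inv z) = unit_inv ((x ^^ k) z)" if "z \<in> G" for z k
  proof (rule unit_inv_eqI[symmetric])
    have "(x ^^ k) z * (x ^^ k) (unit_inv z) = (x ^^ k) (z * unit_inv z)"
      using that by (simp add: pow_mult G_inv)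
    also have "\<dots> = 1" using that by (simp add: unit_inv_right GM pow_one)
    finally show "(x ^^ k) z * (x ^^ k) (unit_inv z) = 1" .
  qed
  obtain n where n: "n > 0" "\<And>z. z \<in> G \<Longrightarrow> (x ^^ n) ((x ^^ n) z) = (x ^^ n) z"
    using funpow_idempotent[OF \<open>finite G\<close>, of x] x_mem GM by blast
  \<comment> \<open>In additive terms \<open>q\<close> is \<open>1 - x^n\<close>, and
    \<open>P m\<close> is \<open>q + x q + ... + x^(m-1) q\<close>, so \<open>P n\<close> is the
    operator \<open>T\<close>.\<close>
  define q where "q = (\<lambda>z. z * unit_inv ((x ^^ n) z))"
  define P where "P = (\<lambda>m z. \<Prod>i<m. (x ^^ i) (q z))"
  have q_mem: "q z \<in> G" if "z \<in> G" for z
    using that by (simp add: q_def G_mult G_inv pow_mem)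
  have q_mult: "q (z * w) = q z * q w" if "z \<in> G" "w \<in> G" for z w
    using that by (simp add: q_def pow_mult unit_inv_mult pow_mem GM ac_simps)
  have pow_q: "(x ^^ n) (q z) = 1" if "z \<in> G" for z
    using that by (simp add: q_def pow_mult pow_inv pow_mem G_inv n(2) unit_inv_right GM)
  then have qq: "q (q z) = q z" if "z \<in> G" for z
    using that by (simp add: q_def[THEN fun_cong, of "q z"] unit_inv_one)
  have P_mem: "P m z \<in> G" if "z \<in> G" for m z
    using that by (induction m) (simp_all add: P_def G_one G_mult pow_mem q_mem)
  have P_mult: "P m (z * w) = P m z * P m w" if "z \<in> G" "w \<in> G" for m z w
    using that by (simp add: P_def q_mult pow_mult q_mem prod.distrib)
  \<comment> \<open>Telescoping: additively, \<open>q + x (P m) = P m + x^m q\<close>. For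
    \<open>m = n\<close> the last term vanishes by \<open>pow_q\<close>.\<close>
  have "q z * x (P m z) = P m z * (x ^^ m) (q z)" if "z \<in> G" for m z
  proof (induction m)
    case 0
    then show ?case by (simp add: P_def x_one)
  next
    case (Suc m)
    have "P (Suc m) z = P m z * (x ^^ m) (q z)" by (simp add: P_def)
    then show ?case
      using Suc that by (simp add: x_mult GM P_mem pow_mem q_mem mult.assoc[symmetric])
  qed
  from this[of _ n] have T: "q z * x (P n z) = P n z" if "z \<in> G" for z
    using that by (simp add: pow_q)
  \<comment> \<open>Additively \<open>(1 - e' d) T e\<close>; the factor \<open>1 - e' d\<close>
    places the degrees of its values in the kernel of \<open>e'\<close>.\<close>
  define f where "f = (\<lambda>\<gamma>. P n (e \<gamma>) * unit_inv (e' (deg (P n (e \<gamma>)))))"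
  note defs = retraction_mem[OF e] P_mem GM homs_mem[OF eh'] homs_mem[OF eh] deg_closed
  have f: "f \<in> homs"
  proof (rule homI)
    show "f \<gamma> \<in> carrier (mult_grp hroots)" if "\<gamma> \<in> carrier \<Gamma>" for \<gamma>
      using that by (simp add: f_def hroots_mult unit_inv_mem defs)
    show "f (\<gamma> \<otimes> \<delta>) = f \<gamma> \<otimes>\<^bsub>mult_grp hroots\<^esub> f \<delta>" if "\<gamma> \<in> carrier \<Gamma>" "\<delta> \<in> carrier \<Gamma>" for \<gamma> \<delta>
      using that by (simp add: f_def homs_mult[OF eh] P_mult homs_deg_mult[OF eh'] unit_inv_mult defs ac_simps)
  qed
  \<comment> \<open>Since \<open>e d\<close> is the identity on \<open>G\<close>, additively
    \<open>e d f = (1 - x) T e = q e\<close>.\<close>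
  have ef: "e (deg (f \<gamma>)) = q (e \<gamma>)" if "\<gamma> \<in> carrier \<Gamma>" for \<gamma>
  proof -
    let ?y = "P n (e \<gamma>)"
    have z: "e \<gamma> \<in> G" using that by (rule retraction_mem[OF e])
    have "e (deg (f \<gamma>)) = ?y * unit_inv (x ?y)"
      using z by (simp add: f_def homs_deg_mult[OF eh] homs_deg_inv[OF eh] unit_inv_mem retraction_deg[OF e] x_def defs)
    also have "\<dots> = q (e \<gamma>) * (x ?y * unit_inv (x ?y))"
      using T[OF z] by (metis mult.assoc)
    also have "\<dots> = q (e \<gamma>)"
      using z by (simp add: unit_inv_right x_mem defs)
    finally show ?thesis .
  qed
  have "f \<gamma> = 1" if "\<gamma> \<in> carrier \<Gamma>" for \<gamma>
  proof (rule stark_idempotent[OF eh' stark f _ _ that])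
    fix \<gamma> assume \<gamma>: "\<gamma> \<in> carrier \<Gamma>"
    \<comment> \<open>\<open>P n\<close> depends on its argument only through \<open>q\<close>, and
      \<open>q\<close> is idempotent. With \<open>ef\<close> this gives
      \<open>f d f = f\<close>.\<close>
    have "P n (q (e \<gamma>)) = P n (e \<gamma>)"
      using \<gamma> by (simp add: P_def qq defs)
    then show "f (deg (f \<gamma>)) = f \<gamma>"
      using ef[OF \<gamma>] by (simp add: f_def)
    show "e' (deg (f \<gamma>)) = 1"
      using \<gamma> by (simp add: f_def homs_deg_mult[OF eh'] homs_deg_inv[OF eh'] unit_inv_mem
          retraction_deg[OF e'] retraction_mem[OF e'] unit_inv_right defs)
  qed
  then have q1: "q (e \<gamma>) = 1" if "\<gamma> \<in> carrier \<Gamma>" for \<gamma>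
    using ef[OF that] that by (simp add: homs_deg_one eh)
  have "(x ^^ n) z = z" if z: "z \<in> G" for z
  proof -
    have "q z = 1" using q1[of "deg z"] z by (simp add: retraction_deg[OF e] defs)
    then have "z * (unit_inv ((x ^^ n) z) * (x ^^ n) z) = (x ^^ n) z"
      unfolding q_def by (simp add: mult.assoc[symmetric])
    then show ?thesis using z by (simp add: unit_inv_left defs pow_mem)
  qed
  then show ?thesis using n(1) unfolding x_def by blast
qed

text \<open>Constructs the idempotent with the kernel of \<open>e\<close> and the image of
  \<open>e'\<close>. The two composition identities express equality of kernels in the form that the
  conjugation argument uses.\<close>

lemma exchange:
  assumes e: "retraction e G" and e': "retraction e' H"
    and n: "n > 0" "\<And>z. z \<in> G \<Longrightarrow> ((\<lambda>z. e (deg (e' (deg z)))) ^^ n) z = z"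
    and m: "m > 0" "\<And>z. z \<in> H \<Longrightarrow> ((\<lambda>z. e' (deg (e (deg z)))) ^^ m) z = z"
  obtains g where "retraction g H" "\<And>\<gamma>. \<gamma> \<in> carrier \<Gamma> \<Longrightarrow> e (deg (g \<gamma>)) = e \<gamma>"
    "\<And>\<gamma>. \<gamma> \<in> carrier \<Gamma> \<Longrightarrow> g (deg (e \<gamma>)) = g \<gamma>"
proof -
  note eh = retraction_homs[OF e] and eh' = retraction_homs[OF e']
  note GM = retraction_subset[OF e] and HM = retraction_subset[OF e']
  define x where "x = (\<lambda>z. e (deg (e' (deg z))))"
  obtain k where k: "n = Suc k" using n(1) gr0_implies_Suc by blast
  obtain l where l: "m = Suc l" using m(1) gr0_implies_Suc by blast
  have x_mem: "x z \<in> G" if "z \<in> G" for z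
    unfolding x_def using that GM by (intro retraction_mem[OF e] deg_closed homs_mem[OF eh'])
  have x_mult: "x (z * w) = x z * x w" if "z \<in> G" "w \<in> G" for z w
    using that by (simp add: x_def homs_deg_mult eh eh' homs_mem deg_closed GM)
  have pow_mem: "(x ^^ k) z \<in> G" if "z \<in> G" for z k
    using x_mem that by (rule funpow_closed)
  have pow_mult: "(x ^^ k) (z * w) = (x ^^ k) z * (x ^^ k) w" if "z \<in> G" "w \<in> G" for z w k
    using that by (induction k) (auto simp: x_mult pow_mem)
  \<comment> \<open>Since \<open>n = Suc k\<close>, the map \<open>g = e' d x^k e\<close> satisfies
    \<open>e d g = x^n e = e\<close>, and it depends on \<gamma> only through
    \<open>e \<gamma>\<close>.\<close>
  define g where "g = (\<lambda>\<gamma>. e' (deg ((x ^^ k) (e \<gamma>))))"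
  note mem = retraction_mem[OF e] pow_mem GM deg_closed
  have eg: "e (deg (g \<gamma>)) = e \<gamma>" if "\<gamma> \<in> carrier \<Gamma>" for \<gamma>
    using n(2)[of "e \<gamma>"] that by (simp add: k g_def x_def[symmetric] x_def[THEN fun_cong, symmetric] mem)
  have g_eqI: "g \<gamma> = g \<delta>" if "e \<gamma> = e \<delta>" for \<gamma> \<delta>
    using that by (simp add: g_def)
  have g_mem: "g \<gamma> \<in> H" if "\<gamma> \<in> carrier \<Gamma>" for \<gamma>
    using that by (simp add: g_def mem retraction_mem[OF e'])
  have g: "g \<in> homs"
    using HM g_mem by (intro homI) (simp_all add: g_def homs_mult[OF eh] pow_mult homs_deg_mult[OF eh'] mem)
  \<comment> \<open>The map \<open>e d\<close> is injective on \<open>H\<close>, because a positive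
    power of \<open>e' d e d\<close> is the identity there. Hence \<open>e d g d = e d\<close>
    forces \<open>g d\<close> to be the identity on \<open>H\<close>.\<close>
  have inj: "z = w" if "z \<in> H" "w \<in> H" "e (deg z) = e (deg w)" for z w
  proof -
    have "((\<lambda>z. e' (deg (e (deg z)))) ^^ m) z = ((\<lambda>z. e' (deg (e (deg z)))) ^^ m) w"
      using that(3) by (simp add: l funpow_Suc_right del: funpow.simps)
    then show ?thesis using m(2) that by simp
  qed
  have gd: "g (deg z) = z" if "z \<in> H" for z
  proof (rule inj[OF _ that])
    have "deg z \<in> carrier \<Gamma>" using that by (simp add: deg_closed HM)
    then show "g (deg z) \<in> H" "e (deg (g (deg z))) = e (deg z)" by (rule g_mem, rule eg)
  qed
  have "H = g ` carrier \<Gamma>"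
  proof (intro equalityI subsetI)
    fix z assume z: "z \<in> H"
    then have "deg z \<in> carrier \<Gamma>" by (simp add: deg_closed HM)
    then show "z \<in> g ` carrier \<Gamma>" using gd[OF z] by (metis imageI)
  qed (use g_mem in auto)
  then have "retraction g H" using g gd by (simp add: retraction_def)
  moreover have "g (deg (e \<gamma>)) = g \<gamma>" if "\<gamma> \<in> carrier \<Gamma>" for \<gamma>
    using that retraction_deg[OF e retraction_mem[OF e]] by (intro g_eqI)
  ultimately show ?thesis using that eg by blast
qed

end

section \<open>The action of \<open>U*(d)\<close>\<close>

context graded
begin

lemma U_act_superset:
  assumes "finite T" "\<And>\<gamma>. comp x \<gamma> \<noteq> 0 \<Longrightarrow> \<gamma> \<in> T"
  shows "U_act \<Gamma> Rg f x = (\<Sum>\<gamma>\<in>T. f \<gamma> * comp x \<gamma>)"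
  unfolding U_act_def Let_def using assms by (intro sum.mono_neutral_left) auto

lemma U_act_add: "U_act \<Gamma> Rg f (x + y) = U_act \<Gamma> Rg f x + U_act \<Gamma> Rg f y"
proof -
  let ?T = "{\<gamma>. comp x \<gamma> \<noteq> 0} \<union> {\<gamma>. comp y \<gamma> \<noteq> 0}"
  have "U_act \<Gamma> Rg f z = (\<Sum>\<gamma>\<in>?T. f \<gamma> * comp z \<gamma>)" if "z \<in> {x, y, x + y}" for z
    using that by (intro U_act_superset) (auto simp: comp_add)
  then show ?thesis
    by (simp add: comp_add distrib_left sum.distrib)
qed

lemma U_act_zero: "U_act \<Gamma> Rg f 0 = 0"
  by (simp add: U_act_def)

lemma U_act_sum: "U_act \<Gamma> Rg f (sum h I) = (\<Sum>i\<in>I. U_act \<Gamma> Rg f (h i))"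
  by (induction I rule: infinite_finite_induct) (simp_all add: U_act_zero U_act_add)

lemma U_act_homogeneous:
  assumes "\<gamma> \<in> carrier \<Gamma>" "x \<in> Rg \<gamma>"
  shows "U_act \<Gamma> Rg f x = f \<gamma> * x"
proof -
  have "U_act \<Gamma> Rg f x = (\<Sum>\<delta>\<in>{\<gamma>}. f \<delta> * comp x \<delta>)"
    by (rule U_act_superset) (simp_all add: comp_homogeneous[OF assms] split: if_splits)
  then show ?thesis by (simp add: comp_homogeneous[OF assms])
qed

lemma U_act_eq_sum: "U_act \<Gamma> Rg f x = (\<Sum>\<gamma>\<in>{\<gamma>. comp x \<gamma> \<noteq> 0}. f \<gamma> * comp x \<gamma>)"
  by (simp add: U_act_def Let_def)

lemma U_act_eq:
  assumes "\<And>\<gamma>. comp x \<gamma> \<noteq> 0 \<Longrightarrow> f \<gamma> = 1"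
  shows "U_act \<Gamma> Rg f x = x"
proof -
  have "U_act \<Gamma> Rg f x = (\<Sum>\<gamma>\<in>{\<gamma>. comp x \<gamma> \<noteq> 0}. comp x \<gamma>)"
    unfolding U_act_eq_sum using assms by (intro sum.cong) auto
  then show ?thesis by (simp add: sum_comp)
qed

lemma U_act_mult:
  assumes f: "f \<in> homs"
  shows "U_act \<Gamma> Rg f (x * y) = U_act \<Gamma> Rg f x * U_act \<Gamma> Rg f y"
proof -
  let ?S = "{\<gamma>. comp x \<gamma> \<noteq> 0}" and ?T = "{\<gamma>. comp y \<gamma> \<noteq> 0}"
  have "U_act \<Gamma> Rg f (x * y) = U_act \<Gamma> Rg f (\<Sum>\<gamma>\<in>?S. \<Sum>\<delta>\<in>?T. comp x \<gamma> * comp y \<delta>)"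
    unfolding sum_product[symmetric] sum_comp ..
  also have "\<dots> = (\<Sum>\<gamma>\<in>?S. \<Sum>\<delta>\<in>?T. f (\<gamma> \<otimes> \<delta>) * (comp x \<gamma> * comp y \<delta>))"
    unfolding U_act_sum
    by (intro sum.cong refl U_act_homogeneous) (auto dest!: comp_carrier intro: mult_mem comp_mem)
  also have "\<dots> = (\<Sum>\<gamma>\<in>?S. \<Sum>\<delta>\<in>?T. (f \<gamma> * comp x \<gamma>) * (f \<delta> * comp y \<delta>))"
    by (intro sum.cong refl) (auto dest!: comp_carrier simp: homs_mult[OF f] ac_simps)
  also have "\<dots> = U_act \<Gamma> Rg f x * U_act \<Gamma> Rg f y"
    unfolding U_act_eq_sum sum_product ..
  finally show ?thesis .
qed

lemma U_act_one: "f \<in> homs \<Longrightarrow> U_act \<Gamma> Rg f 1 = 1"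
  using U_act_homogeneous[OF one_closed one_mem] by (simp add: homs_one)

text \<open>The product of the elements \<open>1 + f\<close> and \<open>1 + h\<close> of \<open>Q(d)\<close>.\<close>

definition star :: "('g \<Rightarrow> 'a) \<Rightarrow> ('g \<Rightarrow> 'a) \<Rightarrow> 'g \<Rightarrow> 'a" where
  "star f h = restrict (\<lambda>\<gamma>. f (\<gamma> \<otimes> deg (h \<gamma>)) * h \<gamma>) (carrier \<Gamma>)"

definition star_one :: "'g \<Rightarrow> 'a" where
  "star_one = restrict (\<lambda>_. 1) (carrier \<Gamma>)"

lemma star_apply: "\<gamma> \<in> carrier \<Gamma> \<Longrightarrow> star f h \<gamma> = f (\<gamma> \<otimes> deg (h \<gamma>)) * h \<gamma>"
  by (simp add: star_def)

lemma star_closed: "f \<in> homs \<Longrightarrow> h \<in> homs \<Longrightarrow> star f h \<in> homs"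
proof (rule homI)
  assume f: "f \<in> homs" and h: "h \<in> homs"
  note mem = homs_mem[OF f] homs_mem[OF h] deg_closed
  show "star f h \<gamma> \<in> carrier (mult_grp hroots)" if "\<gamma> \<in> carrier \<Gamma>" for \<gamma>
    using that by (simp add: star_apply hroots_mult mem)
  show "star f h (\<gamma> \<otimes> \<delta>) = star f h \<gamma> \<otimes>\<^bsub>mult_grp hroots\<^esub> star f h \<delta>"
    if "\<gamma> \<in> carrier \<Gamma>" "\<delta> \<in> carrier \<Gamma>" for \<gamma> \<delta>
    using that by (simp add: star_apply homs_mult[OF f] homs_mult[OF h] deg_mult mem mult.assoc)
qed

lemma star_assoc:
  assumes f: "f \<in> homs" and g: "g \<in> homs" and h: "h \<in> homs"
  shows "star (star f g) h = star f (star g h)"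
proof
  fix \<gamma>
  note mem = homs_mem[OF f] homs_mem[OF g] homs_mem[OF h] deg_closed
  show "star (star f g) h \<gamma> = star f (star g h) \<gamma>"
  proof (cases "\<gamma> \<in> carrier \<Gamma>")
    case True
    then show ?thesis
      by (simp add: star_apply homs_mult[OF f] homs_mult[OF g] homs_deg_mult[OF f] homs_deg_mult[OF g]
          deg_mult hroots_mult mem mult.assoc m_assoc)
  qed (simp add: star_def)
qed

lemma star_one_closed: "star_one \<in> homs"
  by (rule homI) (simp_all add: star_one_def hroots_one)

lemma star_one_left: "h \<in> homs \<Longrightarrow> h \<in> extensional (carrier \<Gamma>) \<Longrightarrow> star star_one h = h"
  by (rule extensionalityI[of _ "carrier \<Gamma>"]) (auto simp: star_def star_one_def deg_closed dest: homs_mem)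

lemma star_one_right: "h \<in> extensional (carrier \<Gamma>) \<Longrightarrow> star h star_one = h"
  by (rule extensionalityI[of _ "carrier \<Gamma>"]) (auto simp: star_def star_one_def deg_one)

text \<open>The action of \<open>h\<close> multiplies \<open>Rg \<gamma>\<close> by
  \<open>h \<gamma>\<close> and so moves it into degree
  \<open>\<gamma> \<otimes> deg (h \<gamma>)\<close>, where \<open>f\<close> acts by its value at
  that degree. This explains the formula for \<open>star\<close>.\<close>

lemma U_act_star:
  assumes h: "h \<in> homs"
  shows "U_act \<Gamma> Rg (star f h) x = U_act \<Gamma> Rg f (U_act \<Gamma> Rg h x)"
proof -
  have "U_act \<Gamma> Rg f (h \<gamma> * comp x \<gamma>) = star f h \<gamma> * comp x \<gamma>" if \<gamma>: "\<gamma> \<in> carrier \<Gamma>" for \<gamma>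
  proof -
    have "comp x \<gamma> * h \<gamma> \<in> Rg (\<gamma> \<otimes> deg (h \<gamma>))"
      using \<gamma> h by (intro mult_mem comp_mem deg_mem) (auto intro: deg_closed homs_mem)
    then show ?thesis
      using U_act_homogeneous[of "\<gamma> \<otimes> deg (h \<gamma>)" "comp x \<gamma> * h \<gamma>" f] \<gamma> h
      by (simp add: star_apply deg_closed homs_mem[OF h] ac_simps)
  qed
  then show ?thesis
    unfolding U_act_eq_sum[of "star f h"] U_act_eq_sum[of h] U_act_sum
    by (intro sum.cong refl) (auto dest: comp_carrier)
qed

lemma U_act_star_one: "U_act \<Gamma> Rg star_one x = x"
  by (rule U_act_eq) (auto simp: star_one_def dest: comp_carrier)

text \<open>The inverse is carried along explicitly: it witnesses membership in
  \<open>U_star\<close> and also inverts the action on the ring.\<close>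

definition inverse_pair :: "('g \<Rightarrow> 'a) \<Rightarrow> ('g \<Rightarrow> 'a) \<Rightarrow> bool" where
  "inverse_pair f f' \<longleftrightarrow> f \<in> homs \<inter> extensional (carrier \<Gamma>) \<and> f' \<in> homs \<inter> extensional (carrier \<Gamma>)
     \<and> star f f' = star_one \<and> star f' f = star_one"

lemma inverse_pair_sym: "inverse_pair f f' \<Longrightarrow> inverse_pair f' f"
  by (auto simp: inverse_pair_def)

lemma inverse_pair_act: "inverse_pair f f' \<Longrightarrow> U_act \<Gamma> Rg f' (U_act \<Gamma> Rg f x) = x"
  using U_act_star[of f f' x] by (simp add: inverse_pair_def U_act_star_one)

lemma inverse_pair_star:
  assumes f: "inverse_pair f f'" and h: "inverse_pair h h'"
  shows "inverse_pair (star f h) (star h' f')"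
proof -
  have ext: "star a b \<in> extensional (carrier \<Gamma>)" for a b by (simp add: star_def)
  have "star (star a b) (star b' a') = star_one" if "inverse_pair a a'" "inverse_pair b b'" for a b a' b'
  proof -
    have mem: "a \<in> homs" "b \<in> homs" "a' \<in> homs" "b' \<in> homs" using that by (auto simp: inverse_pair_def)
    have "star (star a b) (star b' a') = star a (star (star b b') a')"
      using mem by (simp add: star_assoc star_closed)
    also have "\<dots> = star_one"
      using that by (simp add: inverse_pair_def star_one_left)
    finally show ?thesis .
  qed
  from this[OF f h] this[OF inverse_pair_sym[OF h] inverse_pair_sym[OF f]] show ?thesis
    using f h ext by (auto simp: inverse_pair_def star_closed)
qed

text \<open>When both integer parts are 1, the powers in \<open>Q_mult\<close> are first powers and
  the product is \<open>star\<close>; hence \<open>(1, f')\<close> is the required inverse.\<close>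

lemma inverse_pair_U_star:
  assumes "inverse_pair f f'" shows "f \<in> U_star \<Gamma> Rg"
proof -
  have upow_1: "upow a 1 = a" for a :: 'a by (simp add: upow_def)
  have Hom: "h \<in> Hom_mu \<Gamma>" if "h \<in> homs \<inter> extensional (carrier \<Gamma>)" for h
    using that by (auto simp: Hom_mu_def mu_grp_def hom_def hroots_def)
  have mult: "Q_mult \<Gamma> Rg (1, a) (1, b) = (1, star a b)" if a: "a \<in> homs" and b: "b \<in> homs" for a b
    using homs_mult[OF a] homs_mem[OF b]
    by (auto simp: Q_mult_def star_def upow_1 deg_closed ac_simps intro!: restrict_ext)
  have "(1, f') \<in> Q_set \<Gamma>"
    using assms Hom by (simp add: Q_set_def inverse_pair_def)
  moreover have "Q_mult \<Gamma> Rg (1, f) (1, f') = Q_one \<Gamma>" "Q_mult \<Gamma> Rg (1, f') (1, f) = Q_one \<Gamma>"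
    using assms by (simp_all add: mult inverse_pair_def Q_one_def star_one_def)
  ultimately show ?thesis
    using assms Hom unfolding U_star_def inverse_pair_def by blast
qed

section \<open>The units 1 + (g - e)\<close>

definition quot :: "('g \<Rightarrow> 'a) \<Rightarrow> ('g \<Rightarrow> 'a) \<Rightarrow> 'g \<Rightarrow> 'a" where
  "quot g e = restrict (\<lambda>\<gamma>. g \<gamma> * unit_inv (e \<gamma>)) (carrier \<Gamma>)"

lemma quot_apply: "\<gamma> \<in> carrier \<Gamma> \<Longrightarrow> quot g e \<gamma> = g \<gamma> * unit_inv (e \<gamma>)"
  by (simp add: quot_def)

lemma quot_closed:
  assumes g: "g \<in> homs" and e: "e \<in> homs" shows "quot g e \<in> homs"
proof (rule homI)
  note mem = hroots_mult unit_inv_mem homs_mem[OF g] homs_mem[OF e]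
  show "quot g e \<gamma> \<in> carrier (mult_grp hroots)" if "\<gamma> \<in> carrier \<Gamma>" for \<gamma>
    using that by (simp add: quot_apply mem)
  show "quot g e (\<gamma> \<otimes> \<delta>) = quot g e \<gamma> \<otimes>\<^bsub>mult_grp hroots\<^esub> quot g e \<delta>"
    if "\<gamma> \<in> carrier \<Gamma>" "\<delta> \<in> carrier \<Gamma>" for \<gamma> \<delta>
    using that by (simp add: quot_apply homs_mult[OF g] homs_mult[OF e] unit_inv_mult mem)
qed

text \<open>Write \<open>a = g - e\<close> additively, which is \<open>quot g e\<close>. The
  hypothesis \<open>eq\<close> says \<open>a d a = 0\<close>, so \<open>1 + a\<close> and
  \<open>1 - a\<close> multiply to 1.\<close>

lemma star_quot:
  assumes e: "e \<in> homs" and g: "g \<in> homs"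
    and eq: "\<And>\<gamma>. \<gamma> \<in> carrier \<Gamma> \<Longrightarrow> quot g e (deg (e \<gamma>)) = quot g e (deg (g \<gamma>))"
  shows "star (quot g e) (quot e g) = star_one"
proof (rule extensionalityI[of _ "carrier \<Gamma>"])
  fix \<gamma> assume \<gamma>: "\<gamma> \<in> carrier \<Gamma>"
  note q = quot_closed[OF g e]
  note mem = \<gamma> deg_closed homs_mem[OF e] homs_mem[OF g] homs_mem[OF q] unit_inv_mem hroots_mult
  have "quot g e (deg (quot e g \<gamma>)) = quot g e (deg (e \<gamma>)) * unit_inv (quot g e (deg (g \<gamma>)))"
    by (subst quot_apply[OF \<gamma>]) (simp only: homs_deg_mult[OF q] homs_deg_inv[OF q] mem)
  also have "\<dots> = 1"
    unfolding eq[OF \<gamma>] by (intro unit_inv_right mem)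
  finally have "star (quot g e) (quot e g) \<gamma> = quot g e \<gamma> * quot e g \<gamma>"
    using \<gamma> by (simp add: star_apply homs_mult[OF q] homs_mem[OF quot_closed[OF e g]] deg_closed)
  also have "\<dots> = (g \<gamma> * unit_inv (g \<gamma>)) * (e \<gamma> * unit_inv (e \<gamma>))"
    using \<gamma> by (simp add: quot_apply ac_simps)
  finally show "star (quot g e) (quot e g) \<gamma> = star_one \<gamma>"
    by (simp add: unit_inv_right mem star_one_def)
qed (simp_all add: star_def star_one_def)

lemma inverse_pair_quot:
  assumes e: "e \<in> homs" and g: "g \<in> homs"
    and eq: "\<And>\<gamma>. \<gamma> \<in> carrier \<Gamma> \<Longrightarrow> quot g e (deg (e \<gamma>)) = quot g e (deg (g \<gamma>))"
    and eq': "\<And>\<gamma>. \<gamma> \<in> carrier \<Gamma> \<Longrightarrow> quot e g (deg (g \<gamma>)) = quot e g (deg (e \<gamma>))"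
  shows "inverse_pair (quot g e) (quot e g)"
  using star_quot[OF e g eq] star_quot[OF g e eq'] quot_closed[OF e g] quot_closed[OF g e]
  by (simp add: inverse_pair_def) (simp add: quot_def)

section \<open>Orbits of pairs under the unit group\<close>

definition related :: "'a set \<times> 'a set \<Rightarrow> 'a set \<times> 'a set \<Rightarrow> bool" where
  "related X Y \<longleftrightarrow> (\<exists>f f'. inverse_pair f f' \<and> U_act_D \<Gamma> Rg f X = Y)"

lemma related_refl: "related X X"
proof -
  have "inverse_pair star_one star_one"
    using star_one_right[of star_one] star_one_closed by (simp add: inverse_pair_def) (simp add: star_one_def)
  moreover have "U_act_D \<Gamma> Rg star_one X = X" by (simp add: U_act_D_def U_act_star_one)
  ultimately show ?thesis unfolding related_def by blast
qed

lemma related_trans: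
  assumes "related X Y" "related Y Z" shows "related X Z"
proof -
  obtain f f' h h' where f: "inverse_pair f f'" "U_act_D \<Gamma> Rg f X = Y"
    and h: "inverse_pair h h'" "U_act_D \<Gamma> Rg h Y = Z"
    using assms by (auto simp: related_def)
  have "U_act_D \<Gamma> Rg (star h f) X = Z"
    using f h by (auto simp: U_act_D_def U_act_star inverse_pair_def image_image)
  then show ?thesis using inverse_pair_star[OF h(1) f(1)] unfolding related_def by blast
qed

text \<open>The actions of \<open>f\<close> and \<open>f'\<close> are mutually inverse, so
  inclusions in both directions make the images equal.\<close>

lemma relatedI:
  assumes f: "inverse_pair f f'"
    and "\<And>x. x \<in> A \<Longrightarrow> U_act \<Gamma> Rg f x \<in> B" "\<And>x. x \<in> B \<Longrightarrow> U_act \<Gamma> Rg f' x \<in> A"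
    and "\<And>x. x \<in> G \<Longrightarrow> U_act \<Gamma> Rg f x \<in> H" "\<And>x. x \<in> H \<Longrightarrow> U_act \<Gamma> Rg f' x \<in> G"
  shows "related (A, G) (B, H)"
proof -
  note inv = inverse_pair_act[OF inverse_pair_sym[OF f]]
  have "U_act \<Gamma> Rg f ` A = B"
  proof (intro equalityI subsetI)
    fix x assume "x \<in> B"
    then show "x \<in> U_act \<Gamma> Rg f ` A" using assms(3) inv[of x] by (metis imageI)
  qed (use assms(2) in auto)
  moreover have "U_act \<Gamma> Rg f ` G = H"
  proof (intro equalityI subsetI)
    fix x assume "x \<in> H"
    then show "x \<in> U_act \<Gamma> Rg f ` G" using assms(5) inv[of x] by (metis imageI)
  qed (use assms(4) in auto)
  ultimately show ?thesis using f by (auto simp: related_def U_act_D_def)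
qed

text \<open>A unit acts as an injective ring endomorphism, whose restrictions to \<open>A\<close>
  and to \<open>G\<close> are the isomorphisms.\<close>

lemma related_iso:
  assumes "related (A, G) (B, H)"
  shows "(\<exists>\<phi>. ring_iso_on \<phi> A B) \<and> (\<exists>\<psi>. grp_iso_on \<psi> G H)"
proof -
  obtain f f' where f: "inverse_pair f f'" and im: "U_act \<Gamma> Rg f ` A = B" "U_act \<Gamma> Rg f ` G = H"
    using assms by (auto simp: related_def U_act_D_def)
  have homs: "f \<in> homs" using f by (simp add: inverse_pair_def)
  have "inj (U_act \<Gamma> Rg f)" using inverse_pair_act[OF f] by (rule inj_on_inverseI)
  then have "bij_betw (U_act \<Gamma> Rg f) A B" "bij_betw (U_act \<Gamma> Rg f) G H"
    using im by (auto simp: bij_betw_def intro: inj_on_subset)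
  then have "ring_iso_on (U_act \<Gamma> Rg f) A B" "grp_iso_on (U_act \<Gamma> Rg f) G H"
    by (simp_all add: ring_iso_on_def grp_iso_on_def U_act_add U_act_mult[OF homs] U_act_one[OF homs])
  then show ?thesis by blast
qed

lemma U_act_hroot: "z \<in> hroots \<Longrightarrow> U_act \<Gamma> Rg f z = f (deg z) * z"
  by (rule U_act_homogeneous[OF deg_closed deg_mem])

lemma same_kernel:
  assumes e: "e \<in> homs" and g: "g \<in> homs" and "e (deg (g \<gamma>)) = e \<gamma>" "g (deg (e \<gamma>)) = g \<gamma>"
  shows "g \<gamma> = 1 \<longleftrightarrow> e \<gamma> = 1"
  using assms(3,4) homs_deg_one[OF e] homs_deg_one[OF g] by auto

text \<open>The unit is \<open>1 + (g - e)\<close>. From \<open>e d g = e\<close> and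
  \<open>g d e = g\<close> the square of \<open>g - e\<close> is zero. The unit acts trivially in
  degrees of the common kernel and sends \<open>z\<close> in \<open>G\<close> to
  \<open>g (deg z)\<close> in \<open>H\<close>.\<close>

lemma related_same_kernel:
  assumes e: "retraction e G" and g: "retraction g H"
    and eg: "\<And>\<gamma>. \<gamma> \<in> carrier \<Gamma> \<Longrightarrow> e (deg (g \<gamma>)) = e \<gamma>"
    and ge: "\<And>\<gamma>. \<gamma> \<in> carrier \<Gamma> \<Longrightarrow> g (deg (e \<gamma>)) = g \<gamma>"
  shows "related (part {\<gamma>. e \<gamma> = 1}, G) (part {\<gamma>. e \<gamma> = 1}, H)"
proof (rule relatedI)
  note eh = retraction_homs[OF e] and gh = retraction_homs[OF g]
  have ee: "e (deg (e \<gamma>)) = e \<gamma>" and gg: "g (deg (g \<gamma>)) = g \<gamma>" if "\<gamma> \<in> carrier \<Gamma>" for \<gamma>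
    using retraction_deg[OF e retraction_mem[OF e that]] retraction_deg[OF g retraction_mem[OF g that]] .
  note mem = deg_closed homs_mem[OF eh] homs_mem[OF gh]
  show "inverse_pair (quot g e) (quot e g)"
    by (rule inverse_pair_quot[OF eh gh]) (simp_all add: quot_apply mem ee gg eg ge)
  have quot_1: "quot g e \<gamma> = 1" "quot e g \<gamma> = 1"
    if "x \<in> part {\<gamma>. e \<gamma> = 1}" "comp x \<gamma> \<noteq> 0" for x \<gamma>
  proof -
    have "\<gamma> \<in> carrier \<Gamma>" "e \<gamma> = 1" using that by (auto dest: comp_carrier partD)
    moreover from this have "g \<gamma> = 1" using same_kernel[OF eh gh eg ge, of \<gamma>] by simp
    ultimately show "quot g e \<gamma> = 1" "quot e g \<gamma> = 1" by (simp_all add: quot_apply unit_inv_one)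
  qed
  have "U_act \<Gamma> Rg (quot g e) x = x" "U_act \<Gamma> Rg (quot e g) x = x" if "x \<in> part {\<gamma>. e \<gamma> = 1}" for x
    using quot_1[OF that] by (auto intro: U_act_eq)
  then show "U_act \<Gamma> Rg (quot g e) x \<in> part {\<gamma>. e \<gamma> = 1}" "U_act \<Gamma> Rg (quot e g) x \<in> part {\<gamma>. e \<gamma> = 1}"
    if "x \<in> part {\<gamma>. e \<gamma> = 1}" for x using that by simp_all
  \<comment> \<open>The factor is \<open>b (deg z)\<close> divided by \<open>a (deg z)\<close>, and
    the latter is \<open>z\<close> itself, so it cancels.\<close>
  have swap: "U_act \<Gamma> Rg (quot b a) z = b (deg z)" if a: "retraction a K" "z \<in> K" for a b K z
  proof -
    have z: "z \<in> hroots" using a by (rule retraction_subset)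
    then have "U_act \<Gamma> Rg (quot b a) z = b (deg z) * (unit_inv z * z)"
      using retraction_deg[OF a] by (simp add: U_act_hroot quot_apply deg_closed mult.assoc)
    then show ?thesis using z by (simp add: unit_inv_left)
  qed
  show "U_act \<Gamma> Rg (quot g e) z \<in> H" if "z \<in> G" for z
    using that e by (simp add: swap[OF e] retraction_mem[OF g] deg_closed retraction_subset[OF e])
  show "U_act \<Gamma> Rg (quot e g) z \<in> G" if "z \<in> H" for z
    using that e by (simp add: swap[OF g] retraction_mem[OF e] deg_closed retraction_subset[OF g])
qed

text \<open>The unit is \<open>1 + (e - g)\<close>. Both idempotents undo \<open>deg\<close> on
  \<open>G\<close>, so \<open>e - g\<close> is trivial on degrees of elements of \<open>G\<close>;
  hence its square is zero and the unit fixes \<open>G\<close> elementwise.\<close>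

lemma related_same_image:
  assumes e: "retraction e G" and g: "retraction g G"
  shows "related (part {\<gamma>. e \<gamma> = 1}, G) (part {\<gamma>. g \<gamma> = 1}, G)"
proof (rule relatedI)
  have quot_fix: "quot b a (deg z) = 1" if "retraction a G" "retraction b G" "z \<in> G" for a b z
    using retraction_deg[OF that(1,3)] retraction_deg[OF that(2,3)] retraction_subset[OF that(1,3)]
    by (simp add: quot_apply deg_closed unit_inv_right)
  show pair: "inverse_pair (quot e g) (quot g e)"
    using retraction_mem[OF e] retraction_mem[OF g] quot_fix[OF e g] quot_fix[OF g e]
    by (intro inverse_pair_quot retraction_homs[OF e] retraction_homs[OF g]) simp_all
  have move: "U_act \<Gamma> Rg (quot a b) x \<in> part {\<gamma>. b \<gamma> = 1}"
    if a: "retraction a G" and b: "retraction b G" and x: "x \<in> part {\<gamma>. a \<gamma> = 1}" for a b x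
    unfolding U_act_eq_sum
  proof (rule part_sum)
    note bh = retraction_homs[OF b]
    fix \<gamma> assume "\<gamma> \<in> {\<gamma>. comp x \<gamma> \<noteq> 0}"
    then have \<gamma>: "\<gamma> \<in> carrier \<Gamma>" "a \<gamma> = 1" using x by (auto dest: comp_carrier partD)
    let ?z = "unit_inv (b \<gamma>)"
    have z: "?z \<in> hroots" using \<gamma> homs_mem[OF bh] by (simp add: unit_inv_mem)
    \<comment> \<open>Since \<open>a \<gamma> = 1\<close>, the action multiplies the component by
      \<open>?z\<close>. As \<open>?z\<close> lies in \<open>G\<close>, \<open>b\<close> sends
      \<open>deg ?z\<close> back to \<open>?z\<close>, and the new degree falls into the kernel of
      \<open>b\<close>.\<close>
    have "b (\<gamma> \<otimes> deg ?z) = b \<gamma> * ?z"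
      using \<gamma> z retraction_deg[OF b retraction_inv[OF b retraction_mem[OF b]]]
      by (simp add: homs_mult[OF bh] deg_closed)
    also have "\<dots> = 1" using \<gamma> homs_mem[OF bh] by (simp add: unit_inv_right)
    finally have "comp x \<gamma> * ?z \<in> part {\<gamma>. b \<gamma> = 1}"
      using \<gamma> z by (intro part_homogeneous[of "\<gamma> \<otimes> deg ?z"] mult_mem comp_mem deg_mem) (simp_all add: deg_closed)
    then show "quot a b \<gamma> * comp x \<gamma> \<in> part {\<gamma>. b \<gamma> = 1}"
      using \<gamma> by (simp add: quot_apply mult.commute)
  qed
  show "U_act \<Gamma> Rg (quot e g) x \<in> part {\<gamma>. g \<gamma> = 1}" if "x \<in> part {\<gamma>. e \<gamma> = 1}" for x
    using e g that by (rule move)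
  show "U_act \<Gamma> Rg (quot g e) x \<in> part {\<gamma>. e \<gamma> = 1}" if "x \<in> part {\<gamma>. g \<gamma> = 1}" for x
    using g e that by (rule move)
  show "U_act \<Gamma> Rg (quot e g) z \<in> G" "U_act \<Gamma> Rg (quot g e) z \<in> G" if "z \<in> G" for z
    using that quot_fix[OF e g that] quot_fix[OF g e that]
    by (simp_all add: U_act_hroot retraction_subset[OF e])
qed

text \<open>The case of \<open>idempotent_D_of\<close> in which the stable subgroup is the whole of
  \<Gamma>.\<close>

lemma retraction_D_of:
  assumes e: "retraction e G" shows "(part {\<gamma>. e \<gamma> = 1}, G) \<in> DR"
proof -
  have "(part {\<gamma> \<in> carrier \<Gamma>. e \<gamma> = 1}, e ` carrier \<Gamma>) \<in> D_of (part (carrier \<Gamma>))"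
  proof (rule idempotent_D_of[OF retraction_homs[OF e] _ subgroup_self])
    fix \<gamma> assume "\<gamma> \<in> carrier \<Gamma>"
    then show "e (deg (e \<gamma>)) = e \<gamma>" "deg (e \<gamma>) \<in> carrier \<Gamma>"
      using e by (simp_all add: retraction_deg retraction_mem deg_closed retraction_subset)
  qed
  then show ?thesis
    using e unfolding part_Collect_carrier by (simp add: retraction_def)
qed

text \<open>Conversely, \<open>G\<close> is finite, so its elements are roots of unity;
  \<open>D_of_degree\<close> makes them homogeneous, and \<open>e\<close> sends their degrees back
  to them.\<close>

lemma D_of_retraction:
  assumes U: "universal_grading \<Gamma> Rg" and order: "is_order TYPE('a)"
    and connected: "\<And>e::'a. e * e = e \<Longrightarrow> e = 0 \<or> e = 1"
    and AG: "(A, G) \<in> DR"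
  obtains e where "finite G" "retraction e G" "A = part {\<gamma>. e \<gamma> = 1}"
proof -
  obtain e where fin: "finite G" and e: "e \<in> hom \<Gamma> (mult_grp G)" and A: "A = part {\<gamma>. e \<gamma> = 1}"
    and G: "\<And>z. z \<in> G \<Longrightarrow> \<exists>\<gamma>\<in>carrier \<Gamma>. z \<in> Rg \<gamma> \<and> e \<gamma> = z"
    using D_of_degree[OF U order connected AG] by blast
  interpret S: comm_group "mult_grp G" using D_ofD(2)[OF AG] by (rule comm_group_mult_grp)
  have pow: "z [^]\<^bsub>mult_grp G\<^esub> n = z ^ n" if "z \<in> G" for z n
    using that by (induction n) (simp_all add: mult.commute)
  have G_hroots: "z \<in> hroots" if z: "z \<in> G" for z
  proof -
    have "z ^ order (mult_grp G) = 1"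
      using S.pow_order_eq_1[of z] z pow by simp
    moreover have "order (mult_grp G) > 0"
      using fin z by (auto simp: order_def card_gt_0_iff)
    ultimately show ?thesis
      using G[OF z] by (auto simp: hroots_def roots_of_unity_def)
  qed
  have "retraction e G"
    unfolding retraction_def
  proof (intro conjI ballI)
    show "e \<in> homs" using e G_hroots by (auto simp: hom_def)
    show "G = e ` carrier \<Gamma>" using e G by (fastforce simp: hom_def)
    fix z assume z: "z \<in> G"
    then obtain \<gamma> where "\<gamma> \<in> carrier \<Gamma>" "z \<in> Rg \<gamma>" "e \<gamma> = z" using G by blast
    then show "e (deg z) = z" using deg_eq[OF G_hroots[OF z]] by simp
  qed
  then show ?thesis using that fin A by blast
qed

end

theorem theorem6p10:
  fixes \<Gamma> :: "'g monoid" and Rg :: "'g \<Rightarrow> 'a::comm_ring_1 set"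
    and A G B H :: "'a set"
  assumes "is_order TYPE('a)" and "reduced_ring TYPE('a)" and "connected_ring TYPE('a)"
    and "universal_grading \<Gamma> Rg"
    and "(A, G) \<in> DR" and "(B, H) \<in> DR"
    and "stark A" and "stark B"
  shows "(\<exists>\<phi>. ring_iso_on \<phi> A B) \<and> (\<exists>\<psi>. grp_iso_on \<psi> G H) \<and>
    (\<forall>P \<in> {(A, G), (A, H), (B, G), (B, H)}. P \<in> DR \<and>
        (\<exists>f \<in> U_star \<Gamma> Rg. U_act_D \<Gamma> Rg f (A, G) = P))"
proof -
  interpret graded \<Gamma> Rg
    by standard (use assms(4) in \<open>simp add: universal_grading_def\<close>)
  \<comment> \<open>Both 0 and 1 are idempotent, so they exhaust the two-element set of
    idempotents.\<close>
  have connected: "x = 0 \<or> x = 1" if "x * x = x" for x :: 'a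
  proof -
    obtain a b where "{e::'a. e * e = e} = {a, b}"
      using assms(3) unfolding connected_ring_def card_2_iff by blast
    then have "y * y = y \<longleftrightarrow> y = a \<or> y = b" for y :: 'a by blast
    from this[of x] this[of 0] this[of 1] show ?thesis using that by auto
  qed
  obtain e where e: "finite G" "retraction e G" "A = part {\<gamma>. e \<gamma> = 1}"
    using D_of_retraction[OF assms(4,1) connected assms(5)] by blast
  obtain e' where e': "finite H" "retraction e' H" "B = part {\<gamma>. e' \<gamma> = 1}"
    using D_of_retraction[OF assms(4,1) connected assms(6)] by blast
  \<comment> \<open>Starkness of \<open>B\<close> makes \<open>e d e' d\<close> of finite order on
    \<open>G\<close>; with the roles exchanged, starkness of \<open>A\<close> does the same on
    \<open>H\<close>.\<close>
  obtain n where n: "n > 0" "\<And>z. z \<in> G \<Longrightarrow> ((\<lambda>z. e (deg (e' (deg z)))) ^^ n) z = z"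
    using fitting[OF e(2) e'(2) e(1)] assms(8) unfolding e'(3) by blast
  obtain m where m: "m > 0" "\<And>z. z \<in> H \<Longrightarrow> ((\<lambda>z. e' (deg (e (deg z)))) ^^ m) z = z"
    using fitting[OF e'(2) e(2) e'(1)] assms(7) unfolding e(3) by blast
  \<comment> \<open>The idempotent \<open>g\<close> has the kernel of \<open>e\<close> and image
    \<open>H\<close>, so it represents \<open>(A, H)\<close>; symmetrically \<open>g'\<close>
    represents \<open>(B, G)\<close>.\<close>
  obtain g where g: "retraction g H" and eg: "\<And>\<gamma>. \<gamma> \<in> carrier \<Gamma> \<Longrightarrow> e (deg (g \<gamma>)) = e \<gamma>"
    and ge: "\<And>\<gamma>. \<gamma> \<in> carrier \<Gamma> \<Longrightarrow> g (deg (e \<gamma>)) = g \<gamma>"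
    using exchange[OF e(2) e'(2) n m] by blast
  obtain g' where g': "retraction g' G" and eg': "\<And>\<gamma>. \<gamma> \<in> carrier \<Gamma> \<Longrightarrow> e' (deg (g' \<gamma>)) = e' \<gamma>"
    and ge': "\<And>\<gamma>. \<gamma> \<in> carrier \<Gamma> \<Longrightarrow> g' (deg (e' \<gamma>)) = g' \<gamma>"
    using exchange[OF e'(2) e(2) m n] by blast
  have "g \<gamma> = 1 \<longleftrightarrow> e \<gamma> = 1" "g' \<gamma> = 1 \<longleftrightarrow> e' \<gamma> = 1" if "\<gamma> \<in> carrier \<Gamma>" for \<gamma>
    using same_kernel[OF e(2)[THEN retraction_homs] g[THEN retraction_homs] eg ge, OF that that]
      same_kernel[OF e'(2)[THEN retraction_homs] g'[THEN retraction_homs] eg' ge', OF that that] .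
  then have A: "A = part {\<gamma>. g \<gamma> = 1}" and B: "B = part {\<gamma>. g' \<gamma> = 1}"
    unfolding e(3) e'(3) part_def by (auto dest: comp_carrier)
  have AH: "related (A, G) (A, H)"
    unfolding e(3) using e(2) g eg ge by (rule related_same_kernel)
  have AG_BG: "related (A, G) (B, G)"
    unfolding e(3) B using e(2) g' by (rule related_same_image)
  \<comment> \<open>The idempotents \<open>g\<close> and \<open>e'\<close> share the image
    \<open>H\<close>, while their kernels cut out \<open>A\<close> and \<open>B\<close>.\<close>
  have "related (A, H) (B, H)"
    unfolding e'(3) A using g e'(2) by (rule related_same_image)
  with AH have AG_BH: "related (A, G) (B, H)" by (rule related_trans)
  have "(A, H) \<in> DR" using retraction_D_of[OF g] A by simp
  moreover have "(B, G) \<in> DR" using retraction_D_of[OF g'] B by simp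
  moreover have "\<exists>f \<in> U_star \<Gamma> Rg. U_act_D \<Gamma> Rg f (A, G) = P" if "related (A, G) P" for P
    using that inverse_pair_U_star unfolding related_def by blast
  ultimately show ?thesis
    using related_iso[OF AG_BH] related_refl AH AG_BG AG_BH assms(5,6) by blast
qed

end
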